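(* Let $\mathcal{C}$ be a Barr-exact category. Then every split monomorphism in $\mathcal{C}$ is coextensive if and only if $\mathcal{C}$ is coextensive.
   Context: A category is regular if it has finite limits, coequalisers of kernel pairs, and regular epimorphisms are stable under pullback along arbitrary morphisms. A regular category is Barr-exact if every (internal) equivalence relation is effective, i.e. is the kernel pair of some morphism. A binary product diagram is a diagram $A_1 \leftarrow A \rightarrow A_2$ exhibiting $A$ as a product of $A_1$ and $A_2$. A morphism $f\colon A \to X$ is coextensive if it satisfies both of the following conditions. (C1) For every product diagram $A_1 \xleftarrow{a_1} A \xrightarrow{a_2} A_2$, the pushouts of $f$ along $a_1$ and along $a_2$ exist, and the resulting morphisms $X_1 \leftarrow X \rightarrow X_2$ (where $X_i$ is the pushout of $f$ along $a_i$) form a product diagram. (C2) For every commutative diagram consisting of morphisms $a_i\colon A\to A_i$, $x_i\colon X \to X_i$, $f_i\colon A_i\to X_i$ with $f_i a_i = x_i f$ ($i=1,2$), where $A_1 \xleftarrow{a_1} A \xrightarrow{a_2} A_2$ is a product diagram, if $X_1 \xleftarrow{x_1} X \xrightarrow{x_2} X_2$ is a product diagram, then both squares $f_i a_i = x_i f$ are pushouts. A category with finite products is coextensive if and only if every morphism in it is coextensive (equivalently, its opposite category is extensive in the sense of Carboni, Lack and Walters). *)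

theory Defs
  imports Main
begin

record ('o, 'm) cat =
  Obj :: "'o set"
  Arr :: "'m set"
  Dom :: "'m \<Rightarrow> 'o"
  Cod :: "'m \<Rightarrow> 'o"
  Id :: "'o \<Rightarrow> 'm"
  Comp :: "'m \<Rightarrow> 'm \<Rightarrow> 'm"  (infixl "\<cdot>\<index>" 70)

text \<open>Composition is in applicative order (first the right factor, then the left one). The
  operations are unconstrained outside the carriers and on non-composable pairs.\<close>

definition hom :: "('o, 'm) cat \<Rightarrow> 'o \<Rightarrow> 'o \<Rightarrow> 'm set" where
  "hom C A B = {f \<in> Arr C. Dom C f = A \<and> Cod C f = B}"

locale category =
  fixes C :: "('o, 'm) cat" (structure)
  assumes dom_obj: "f \<in> Arr C \<Longrightarrow> Dom C f \<in> Obj C"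
    and cod_obj: "f \<in> Arr C \<Longrightarrow> Cod C f \<in> Obj C"
    and id_hom: "A \<in> Obj C \<Longrightarrow> Id C A \<in> hom C A A"
    and comp_hom: "\<lbrakk>g \<in> Arr C; f \<in> Arr C; Dom C g = Cod C f\<rbrakk>
                    \<Longrightarrow> g \<cdot> f \<in> hom C (Dom C f) (Cod C g)"
    and id_left: "f \<in> Arr C \<Longrightarrow> Id C (Cod C f) \<cdot> f = f"
    and id_right: "f \<in> Arr C \<Longrightarrow> f \<cdot> Id C (Dom C f) = f"
    and assoc: "\<lbrakk>h \<in> Arr C; g \<in> Arr C; f \<in> Arr C; Dom C h = Cod C g; Dom C g = Cod C f\<rbrakk>
                    \<Longrightarrow> (h \<cdot> g) \<cdot> f = h \<cdot> (g \<cdot> f)"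

definition is_functor ::
    "('j, 'k) cat \<Rightarrow> ('o, 'm) cat \<Rightarrow> ('j \<Rightarrow> 'o) \<Rightarrow> ('k \<Rightarrow> 'm) \<Rightarrow> bool" where
  "is_functor J C Fo Fm \<longleftrightarrow>
     (\<forall>j\<in>Obj J. Fo j \<in> Obj C) \<and>
     (\<forall>u\<in>Arr J. Fm u \<in> hom C (Fo (Dom J u)) (Fo (Cod J u))) \<and>
     (\<forall>j\<in>Obj J. Fm (Id J j) = Id C (Fo j)) \<and>
     (\<forall>v\<in>Arr J. \<forall>u\<in>Arr J. Dom J v = Cod J u \<longrightarrow> Fm (v \<cdot>\<^bsub>J\<^esub> u) = Fm v \<cdot>\<^bsub>C\<^esub> Fm u)"

definition is_cone ::
    "('j, 'k) cat \<Rightarrow> ('o, 'm) cat \<Rightarrow> ('j \<Rightarrow> 'o) \<Rightarrow> ('k \<Rightarrow> 'm) \<Rightarrow> 'o \<Rightarrow> ('j \<Rightarrow> 'm) \<Rightarrow> bool" where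
  "is_cone J C Fo Fm L p \<longleftrightarrow>
     L \<in> Obj C \<and>
     (\<forall>j\<in>Obj J. p j \<in> hom C L (Fo j)) \<and>
     (\<forall>u\<in>Arr J. Fm u \<cdot>\<^bsub>C\<^esub> p (Dom J u) = p (Cod J u))"

definition is_limit ::
    "('j, 'k) cat \<Rightarrow> ('o, 'm) cat \<Rightarrow> ('j \<Rightarrow> 'o) \<Rightarrow> ('k \<Rightarrow> 'm) \<Rightarrow> 'o \<Rightarrow> ('j \<Rightarrow> 'm) \<Rightarrow> bool" where
  "is_limit J C Fo Fm L p \<longleftrightarrow>
     is_cone J C Fo Fm L p \<and>
     (\<forall>T t. is_cone J C Fo Fm T t \<longrightarrow>
        (\<exists>!h. h \<in> hom C T L \<and> (\<forall>j\<in>Obj J. p j \<cdot>\<^bsub>C\<^esub> h = t j)))"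

definition has_limits_of_shape :: "('j, 'k) cat \<Rightarrow> ('o, 'm) cat \<Rightarrow> bool" where
  "has_limits_of_shape J C \<longleftrightarrow>
     (\<forall>Fo Fm. is_functor J C Fo Fm \<longrightarrow> (\<exists>L p. is_limit J C Fo Fm L p))"

definition finite_category :: "('j, 'k) cat \<Rightarrow> bool" where
  "finite_category J \<longleftrightarrow> category J \<and> finite (Obj J) \<and> finite (Arr J)"

definition discrete_category :: "('j, 'k) cat \<Rightarrow> bool" where
  "discrete_category J \<longleftrightarrow> category J \<and> Arr J = Id J ` Obj J"

text \<open>Shapes are taken over the type of natural numbers; since every finite category is
  isomorphic to one whose objects and arrows are natural numbers, this is no restriction.\<close>

definition has_finite_limits :: "('o, 'm) cat \<Rightarrow> bool" where
  "has_finite_limits C \<longleftrightarrow>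
     (\<forall>J :: (nat, nat) cat. finite_category J \<longrightarrow> has_limits_of_shape J C)"

definition has_finite_products :: "('o, 'm) cat \<Rightarrow> bool" where
  "has_finite_products C \<longleftrightarrow>
     (\<forall>J :: (nat, nat) cat. finite_category J \<and> discrete_category J \<longrightarrow> has_limits_of_shape J C)"

text \<open>The diagram \<open>Cod p \<leftarrow> Dom p = Dom q \<rightarrow> Cod q\<close> exhibits a binary product.\<close>

definition is_product_diagram :: "('o, 'm) cat \<Rightarrow> 'm \<Rightarrow> 'm \<Rightarrow> bool" where
  "is_product_diagram C p q \<longleftrightarrow>
     p \<in> Arr C \<and> q \<in> Arr C \<and> Dom C p = Dom C q \<and>
     (\<forall>T\<in>Obj C. \<forall>u \<in> hom C T (Cod C p). \<forall>v \<in> hom C T (Cod C q).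
        \<exists>!h. h \<in> hom C T (Dom C p) \<and> p \<cdot>\<^bsub>C\<^esub> h = u \<and> q \<cdot>\<^bsub>C\<^esub> h = v)"

text \<open>The square \<open>f p = g q\<close> is a pullback; \<open>q\<close> is the pullback of \<open>f\<close> along \<open>g\<close>.\<close>

definition is_pullback :: "('o, 'm) cat \<Rightarrow> 'm \<Rightarrow> 'm \<Rightarrow> 'm \<Rightarrow> 'm \<Rightarrow> bool" where
  "is_pullback C f g p q \<longleftrightarrow>
     f \<in> Arr C \<and> g \<in> Arr C \<and> p \<in> Arr C \<and> q \<in> Arr C \<and>
     Cod C f = Cod C g \<and> Dom C p = Dom C q \<and> Cod C p = Dom C f \<and> Cod C q = Dom C g \<and>
     f \<cdot>\<^bsub>C\<^esub> p = g \<cdot>\<^bsub>C\<^esub> q \<and>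
     (\<forall>T\<in>Obj C. \<forall>u \<in> hom C T (Dom C f). \<forall>v \<in> hom C T (Dom C g).
        f \<cdot>\<^bsub>C\<^esub> u = g \<cdot>\<^bsub>C\<^esub> v \<longrightarrow>
        (\<exists>!h. h \<in> hom C T (Dom C p) \<and> p \<cdot>\<^bsub>C\<^esub> h = u \<and> q \<cdot>\<^bsub>C\<^esub> h = v))"

text \<open>The square \<open>b a = x f\<close> is a pushout; \<open>Cod x = Cod b\<close> is the pushout of \<open>f\<close> along \<open>a\<close>.\<close>

definition is_pushout :: "('o, 'm) cat \<Rightarrow> 'm \<Rightarrow> 'm \<Rightarrow> 'm \<Rightarrow> 'm \<Rightarrow> bool" where
  "is_pushout C f a x b \<longleftrightarrow>
     f \<in> Arr C \<and> a \<in> Arr C \<and> x \<in> Arr C \<and> b \<in> Arr C \<and>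
     Dom C f = Dom C a \<and> Cod C x = Cod C b \<and> Dom C x = Cod C f \<and> Dom C b = Cod C a \<and>
     b \<cdot>\<^bsub>C\<^esub> a = x \<cdot>\<^bsub>C\<^esub> f \<and>
     (\<forall>T\<in>Obj C. \<forall>u \<in> hom C (Cod C f) T. \<forall>v \<in> hom C (Cod C a) T.
        v \<cdot>\<^bsub>C\<^esub> a = u \<cdot>\<^bsub>C\<^esub> f \<longrightarrow>
        (\<exists>!h. h \<in> hom C (Cod C x) T \<and> h \<cdot>\<^bsub>C\<^esub> x = u \<and> h \<cdot>\<^bsub>C\<^esub> b = v))"

definition is_kernel_pair :: "('o, 'm) cat \<Rightarrow> 'm \<Rightarrow> 'm \<Rightarrow> 'm \<Rightarrow> bool" where
  "is_kernel_pair C f r0 r1 \<longleftrightarrow> is_pullback C f f r0 r1"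

definition is_coequaliser :: "('o, 'm) cat \<Rightarrow> 'm \<Rightarrow> 'm \<Rightarrow> 'm \<Rightarrow> bool" where
  "is_coequaliser C r0 r1 e \<longleftrightarrow>
     r0 \<in> Arr C \<and> r1 \<in> Arr C \<and> e \<in> Arr C \<and>
     Dom C r0 = Dom C r1 \<and> Cod C r0 = Cod C r1 \<and> Dom C e = Cod C r0 \<and>
     e \<cdot>\<^bsub>C\<^esub> r0 = e \<cdot>\<^bsub>C\<^esub> r1 \<and>
     (\<forall>T\<in>Obj C. \<forall>u \<in> hom C (Dom C e) T. u \<cdot>\<^bsub>C\<^esub> r0 = u \<cdot>\<^bsub>C\<^esub> r1 \<longrightarrow>
        (\<exists>!h. h \<in> hom C (Cod C e) T \<and> h \<cdot>\<^bsub>C\<^esub> e = u))"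

definition regular_epi :: "('o, 'm) cat \<Rightarrow> 'm \<Rightarrow> bool" where
  "regular_epi C e \<longleftrightarrow> (\<exists>r0 r1. is_coequaliser C r0 r1 e)"

definition regular_category :: "('o, 'm) cat \<Rightarrow> bool" where
  "regular_category C \<longleftrightarrow>
     category C \<and> has_finite_limits C \<and>
     (\<forall>f r0 r1. is_kernel_pair C f r0 r1 \<longrightarrow> (\<exists>e. is_coequaliser C r0 r1 e)) \<and>
     (\<forall>e g p q. regular_epi C e \<and> is_pullback C e g p q \<longrightarrow> regular_epi C q)"

definition jointly_monic :: "('o, 'm) cat \<Rightarrow> 'm \<Rightarrow> 'm \<Rightarrow> bool" where
  "jointly_monic C r0 r1 \<longleftrightarrow>
     (\<forall>T\<in>Obj C. \<forall>u \<in> hom C T (Dom C r0). \<forall>v \<in> hom C T (Dom C r0).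
        r0 \<cdot>\<^bsub>C\<^esub> u = r0 \<cdot>\<^bsub>C\<^esub> v \<and> r1 \<cdot>\<^bsub>C\<^esub> u = r1 \<cdot>\<^bsub>C\<^esub> v \<longrightarrow> u = v)"

text \<open>The last three conjuncts are internal reflexivity, symmetry and transitivity. In the last
  one, the domain of \<open>p\<close> and \<open>q\<close> is the object of composable pairs of the relation.\<close>

definition equivalence_relation :: "('o, 'm) cat \<Rightarrow> 'm \<Rightarrow> 'm \<Rightarrow> bool" where
  "equivalence_relation C r0 r1 \<longleftrightarrow>
     r0 \<in> Arr C \<and> r1 \<in> Arr C \<and> Dom C r0 = Dom C r1 \<and> Cod C r0 = Cod C r1 \<and>
     jointly_monic C r0 r1 \<and>
     (\<exists>d \<in> hom C (Cod C r0) (Dom C r0).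
        r0 \<cdot>\<^bsub>C\<^esub> d = Id C (Cod C r0) \<and> r1 \<cdot>\<^bsub>C\<^esub> d = Id C (Cod C r0)) \<and>
     (\<exists>s \<in> hom C (Dom C r0) (Dom C r0). r0 \<cdot>\<^bsub>C\<^esub> s = r1 \<and> r1 \<cdot>\<^bsub>C\<^esub> s = r0) \<and>
     (\<forall>p q. is_pullback C r1 r0 p q \<longrightarrow>
        (\<exists>t \<in> hom C (Dom C p) (Dom C r0).
           r0 \<cdot>\<^bsub>C\<^esub> t = r0 \<cdot>\<^bsub>C\<^esub> p \<and> r1 \<cdot>\<^bsub>C\<^esub> t = r1 \<cdot>\<^bsub>C\<^esub> q))"

definition barr_exact :: "('o, 'm) cat \<Rightarrow> bool" where
  "barr_exact C \<longleftrightarrow>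
     regular_category C \<and>
     (\<forall>r0 r1. equivalence_relation C r0 r1 \<longrightarrow> (\<exists>f. is_kernel_pair C f r0 r1))"

definition split_mono :: "('o, 'm) cat \<Rightarrow> 'm \<Rightarrow> bool" where
  "split_mono C f \<longleftrightarrow>
     f \<in> Arr C \<and> (\<exists>g \<in> hom C (Cod C f) (Dom C f). g \<cdot>\<^bsub>C\<^esub> f = Id C (Dom C f))"

definition coextensive_C1 :: "('o, 'm) cat \<Rightarrow> 'm \<Rightarrow> bool" where
  "coextensive_C1 C f \<longleftrightarrow>
     (\<forall>a1 a2. is_product_diagram C a1 a2 \<and> Dom C a1 = Dom C f \<longrightarrow>
        (\<exists>x1 f1. is_pushout C f a1 x1 f1) \<and>
        (\<exists>x2 f2. is_pushout C f a2 x2 f2) \<and>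
        (\<forall>x1 f1 x2 f2. is_pushout C f a1 x1 f1 \<and> is_pushout C f a2 x2 f2 \<longrightarrow>
           is_product_diagram C x1 x2))"

definition coextensive_C2 :: "('o, 'm) cat \<Rightarrow> 'm \<Rightarrow> bool" where
  "coextensive_C2 C f \<longleftrightarrow>
     (\<forall>a1 a2 x1 x2 f1 f2.
        is_product_diagram C a1 a2 \<and> Dom C a1 = Dom C f \<and>
        is_product_diagram C x1 x2 \<and> Dom C x1 = Cod C f \<and>
        f1 \<in> hom C (Cod C a1) (Cod C x1) \<and> f2 \<in> hom C (Cod C a2) (Cod C x2) \<and>
        f1 \<cdot>\<^bsub>C\<^esub> a1 = x1 \<cdot>\<^bsub>C\<^esub> f \<and> f2 \<cdot>\<^bsub>C\<^esub> a2 = x2 \<cdot>\<^bsub>C\<^esub> f \<longrightarrow>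
        is_pushout C f a1 x1 f1 \<and> is_pushout C f a2 x2 f2)"

definition coextensive_morphism :: "('o, 'm) cat \<Rightarrow> 'm \<Rightarrow> bool" where
  "coextensive_morphism C f \<longleftrightarrow> f \<in> Arr C \<and> coextensive_C1 C f \<and> coextensive_C2 C f"

definition coextensive_category :: "('o, 'm) cat \<Rightarrow> bool" where
  "coextensive_category C \<longleftrightarrow>
     category C \<and> has_finite_products C \<and> (\<forall>f\<in>Arr C. coextensive_morphism C f)"

end

theory Submission imports Defs
begin

text \<open>Condition (C2) for the identity of a subterminal object forces it to be terminal. Hence every
  object covers \<open>1\<close>, and all product projections are regular epimorphisms. A morphism \<open>f : A \<rightarrow> X\<close>
  is the split monomorphism \<open>(1, f) : A \<rightarrow> A \<times> X\<close> followed by the projection to \<open>X\<close>, so it remains to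
  descend (C1) and (C2) along that projection. For (C2) this is immediate, because
  \<open>A\<^sub>1 \<times> X\<^sub>1 \<rightarrow> X\<^sub>1\<close> is a regular epimorphism. For (C1), both \<open>A \<times> X\<close> and the kernel pair of
  \<open>A \<times> X \<rightarrow> X\<close> receive split monomorphisms from \<open>A\<close> and hence decompose along \<open>A = A\<^sub>1 \<times> A\<^sub>2\<close>. The
  components of the kernel pair are again equivalence relations, and exactness provides their
  quotients, whose product is \<open>X\<close>.\<close>

section \<open>Arrows and universal properties\<close>

context category
begin

lemma comp_arr [simp]: "\<lbrakk>g \<in> Arr C; f \<in> Arr C; Dom C g = Cod C f\<rbrakk> \<Longrightarrow> g \<cdot> f \<in> Arr C"
  and dom_comp [simp]: "\<lbrakk>g \<in> Arr C; f \<in> Arr C; Dom C g = Cod C f\<rbrakk> \<Longrightarrow> Dom C (g \<cdot> f) = Dom C f"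
  and cod_comp [simp]: "\<lbrakk>g \<in> Arr C; f \<in> Arr C; Dom C g = Cod C f\<rbrakk> \<Longrightarrow> Cod C (g \<cdot> f) = Cod C g"
  using comp_hom by (auto simp: hom_def)

lemma id_arr [simp]: "A \<in> Obj C \<Longrightarrow> Id C A \<in> Arr C"
  and dom_id [simp]: "A \<in> Obj C \<Longrightarrow> Dom C (Id C A) = A"
  and cod_id [simp]: "A \<in> Obj C \<Longrightarrow> Cod C (Id C A) = A"
  using id_hom by (auto simp: hom_def)

lemma id_comp [simp]: "\<lbrakk>f \<in> Arr C; Cod C f = A\<rbrakk> \<Longrightarrow> Id C A \<cdot> f = f"
  and comp_id [simp]: "\<lbrakk>f \<in> Arr C; Dom C f = A\<rbrakk> \<Longrightarrow> f \<cdot> Id C A = f"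
  using id_left id_right by auto

declare assoc [simp]
declare dom_obj [simp] cod_obj [simp]

lemma hom_dom_obj: "f \<in> hom C A B \<Longrightarrow> A \<in> Obj C"
  and hom_cod_obj: "f \<in> hom C A B \<Longrightarrow> B \<in> Obj C"
  using dom_obj cod_obj by (auto simp: hom_def)

text \<open>Since \<open>assoc\<close> rewrites composites to the right, an equation
  \<open>f \<cdot> g = k\<close> no longer matches once a further factor follows; this form applies
  it there.\<close>

lemma comp_eq_comp:
  "\<lbrakk>f \<cdot> g = k; f \<in> Arr C; g \<in> Arr C; w \<in> Arr C; Dom C f = Cod C g; Dom C g = Cod C w\<rbrakk>
    \<Longrightarrow> f \<cdot> (g \<cdot> w) = k \<cdot> w"
  using assoc by metis

section \<open>Universal properties in terms of named hom-sets\<close>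

lemma product_ex1:
  assumes "is_product_diagram C p q" "p \<in> hom C P A" "q \<in> hom C P B"
    and "u \<in> hom C T A" "v \<in> hom C T B"
  shows "\<exists>!h. h \<in> hom C T P \<and> p \<cdot> h = u \<and> q \<cdot> h = v"
proof -
  have eqs: "Dom C p = P" "Cod C p = A" "Cod C q = B"
    using assms(2,3) by (simp_all add: hom_def)
  have "\<forall>T\<in>Obj C. \<forall>u \<in> hom C T (Cod C p). \<forall>v \<in> hom C T (Cod C q).
        \<exists>!h. h \<in> hom C T (Dom C p) \<and> p \<cdot> h = u \<and> q \<cdot> h = v"
    using assms(1) unfolding is_product_diagram_def by (elim conjE)
  then show ?thesis
    unfolding eqs using assms(4,5) hom_dom_obj[OF assms(4)] by blast
qed

lemma product_lift:
  assumes "is_product_diagram C p q" "p \<in> hom C P A" "q \<in> hom C P B"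
    and "u \<in> hom C T A" "v \<in> hom C T B"
  obtains h where "h \<in> hom C T P" "p \<cdot> h = u" "q \<cdot> h = v"
  using product_ex1[OF assms] that by blast

lemma product_eqI:
  assumes "is_product_diagram C p q" "p \<in> hom C P A" "q \<in> hom C P B"
    and "h \<in> hom C T P" "k \<in> hom C T P" "p \<cdot> h = p \<cdot> k" "q \<cdot> h = q \<cdot> k"
  shows "h = k"
proof -
  have "p \<cdot> k \<in> hom C T A" "q \<cdot> k \<in> hom C T B" using assms by (auto simp: hom_def)
  from product_ex1[OF assms(1-3) this] show ?thesis using assms(4-7) by blast
qed

lemma product_diagramI:
  assumes "p \<in> hom C P A" "q \<in> hom C P B"
    and "\<And>T u v. \<lbrakk>u \<in> hom C T A; v \<in> hom C T B\<rbrakk> \<Longrightarrow> \<exists>h\<in>hom C T P. p \<cdot> h = u \<and> q \<cdot> h = v"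
    and "\<And>T h k. \<lbrakk>h \<in> hom C T P; k \<in> hom C T P; p \<cdot> h = p \<cdot> k; q \<cdot> h = q \<cdot> k\<rbrakk> \<Longrightarrow> h = k"
  shows "is_product_diagram C p q"
proof -
  have "\<exists>!h. h \<in> hom C T P \<and> p \<cdot> h = u \<and> q \<cdot> h = v"
    if uv: "u \<in> hom C T A" "v \<in> hom C T B" for T u v
  proof -
    obtain h where h: "h \<in> hom C T P" "p \<cdot> h = u" "q \<cdot> h = v" using assms(3)[OF uv] by blast
    show ?thesis
    proof (rule ex1I[of _ h])
      fix k assume "k \<in> hom C T P \<and> p \<cdot> k = u \<and> q \<cdot> k = v"
      then show "k = h" using h assms(4)[of k T h] by simp
    qed (use h in simp)
  qed
  moreover have "p \<in> Arr C" "q \<in> Arr C" "Dom C p = P" "Dom C q = P" "Cod C p = A" "Cod C q = B"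
    using assms(1,2) by (auto simp: hom_def)
  ultimately show ?thesis unfolding is_product_diagram_def by simp
qed

lemma product_swap: "is_product_diagram C p q \<Longrightarrow> is_product_diagram C q p"
  unfolding is_product_diagram_def by (metis (no_types, lifting))

lemma pullback_ex1:
  assumes "is_pullback C f g p q" "p \<in> hom C P A" "q \<in> hom C P B"
    and "u \<in> hom C T A" "v \<in> hom C T B" "f \<cdot> u = g \<cdot> v"
  shows "\<exists>!h. h \<in> hom C T P \<and> p \<cdot> h = u \<and> q \<cdot> h = v"
proof -
  have eqs: "Dom C p = P" "Dom C f = A" "Dom C g = B"
    using assms(1-3) by (auto simp: hom_def is_pullback_def)
  have "\<forall>T\<in>Obj C. \<forall>u \<in> hom C T (Dom C f). \<forall>v \<in> hom C T (Dom C g). f \<cdot> u = g \<cdot> v \<longrightarrow>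
        (\<exists>!h. h \<in> hom C T (Dom C p) \<and> p \<cdot> h = u \<and> q \<cdot> h = v)"
    using assms(1) unfolding is_pullback_def by (elim conjE)
  then show ?thesis
    unfolding eqs using assms(4-6) hom_dom_obj[OF assms(4)] by blast
qed

lemma pullback_lift:
  assumes "is_pullback C f g p q" "p \<in> hom C P A" "q \<in> hom C P B"
    and "u \<in> hom C T A" "v \<in> hom C T B" "f \<cdot> u = g \<cdot> v"
  obtains h where "h \<in> hom C T P" "p \<cdot> h = u" "q \<cdot> h = v"
  using pullback_ex1[OF assms] that by blast

lemma pullback_eqI:
  assumes "is_pullback C f g p q" "p \<in> hom C P A" "q \<in> hom C P B"
    and "h \<in> hom C T P" "k \<in> hom C T P" "p \<cdot> h = p \<cdot> k" "q \<cdot> h = q \<cdot> k"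
  shows "h = k"
proof -
  have *: "f \<in> Arr C" "g \<in> Arr C" "Dom C f = A" "Dom C g = B" "f \<cdot> p = g \<cdot> q"
    using assms(1-3) by (auto simp: hom_def is_pullback_def)
  have "p \<cdot> k \<in> hom C T A" "q \<cdot> k \<in> hom C T B" using assms by (auto simp: hom_def)
  moreover have "f \<cdot> (p \<cdot> k) = g \<cdot> (q \<cdot> k)"
    using * assms(2,3,5) comp_eq_comp[OF *(5)] by (simp add: hom_def)
  ultimately show ?thesis using pullback_ex1[OF assms(1-3)] assms(4-7) by blast
qed

lemma pullback_arrows:
  assumes "is_pullback C f g p q"
  shows "f \<in> hom C (Dom C f) (Cod C f)" "g \<in> hom C (Dom C g) (Cod C f)"
    "p \<in> hom C (Dom C p) (Dom C f)" "q \<in> hom C (Dom C p) (Dom C g)" "f \<cdot> p = g \<cdot> q"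
  using assms unfolding is_pullback_def hom_def by auto

lemma pullbackI:
  assumes "f \<in> hom C A X" "g \<in> hom C B X" "p \<in> hom C P A" "q \<in> hom C P B" "f \<cdot> p = g \<cdot> q"
    and "\<And>T u v. \<lbrakk>u \<in> hom C T A; v \<in> hom C T B; f \<cdot> u = g \<cdot> v\<rbrakk>
           \<Longrightarrow> \<exists>h\<in>hom C T P. p \<cdot> h = u \<and> q \<cdot> h = v"
    and "\<And>T h k. \<lbrakk>h \<in> hom C T P; k \<in> hom C T P; p \<cdot> h = p \<cdot> k; q \<cdot> h = q \<cdot> k\<rbrakk> \<Longrightarrow> h = k"
  shows "is_pullback C f g p q"
proof -
  have "\<exists>!h. h \<in> hom C T P \<and> p \<cdot> h = u \<and> q \<cdot> h = v"
    if uv: "u \<in> hom C T A" "v \<in> hom C T B" "f \<cdot> u = g \<cdot> v" for T u v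
  proof -
    obtain h where h: "h \<in> hom C T P" "p \<cdot> h = u" "q \<cdot> h = v" using assms(6)[OF uv] by blast
    show ?thesis
    proof (rule ex1I[of _ h])
      fix k assume "k \<in> hom C T P \<and> p \<cdot> k = u \<and> q \<cdot> k = v"
      then show "k = h" using h assms(7)[of k T h] by simp
    qed (use h in simp)
  qed
  moreover have "p \<in> Arr C" "q \<in> Arr C" "Dom C p = P" "Dom C q = P" "Cod C p = A" "Cod C q = B"
    "f \<in> Arr C" "g \<in> Arr C" "Dom C f = A" "Dom C g = B" "Cod C f = X" "Cod C g = X"
    using assms(1-4) by (auto simp: hom_def)
  ultimately show ?thesis using assms(5) unfolding is_pullback_def by simp
qed

lemma pushout_ex1:
  assumes "is_pushout C f a x b" "x \<in> hom C X Q" "b \<in> hom C B Q"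
    and "u \<in> hom C X T" "v \<in> hom C B T" "v \<cdot> a = u \<cdot> f"
  shows "\<exists>!h. h \<in> hom C Q T \<and> h \<cdot> x = u \<and> h \<cdot> b = v"
proof -
  have eqs: "Cod C f = X" "Cod C a = B" "Cod C x = Q"
    using assms(1-3) by (auto simp: hom_def is_pushout_def)
  have "\<forall>T\<in>Obj C. \<forall>u \<in> hom C (Cod C f) T. \<forall>v \<in> hom C (Cod C a) T. v \<cdot> a = u \<cdot> f \<longrightarrow>
        (\<exists>!h. h \<in> hom C (Cod C x) T \<and> h \<cdot> x = u \<and> h \<cdot> b = v)"
    using assms(1) unfolding is_pushout_def by (elim conjE)
  then show ?thesis
    unfolding eqs using assms(4-6) hom_cod_obj[OF assms(4)] by blast
qed

lemma pushout_factor: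
  assumes "is_pushout C f a x b" "x \<in> hom C X Q" "b \<in> hom C B Q"
    and "u \<in> hom C X T" "v \<in> hom C B T" "v \<cdot> a = u \<cdot> f"
  obtains h where "h \<in> hom C Q T" "h \<cdot> x = u" "h \<cdot> b = v"
  using pushout_ex1[OF assms] that by blast

lemma pushout_eqI:
  assumes "is_pushout C f a x b" "x \<in> hom C X Q" "b \<in> hom C B Q"
    and "h \<in> hom C Q T" "k \<in> hom C Q T" "h \<cdot> x = k \<cdot> x" "h \<cdot> b = k \<cdot> b"
  shows "h = k"
proof -
  have *: "f \<in> Arr C" "a \<in> Arr C" "Cod C f = X" "Cod C a = B" "Dom C f = Dom C a" "b \<cdot> a = x \<cdot> f"
    using assms(1-3) by (auto simp: hom_def is_pushout_def)
  have "k \<cdot> x \<in> hom C X T" "k \<cdot> b \<in> hom C B T" using assms by (auto simp: hom_def)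
  moreover have "(k \<cdot> b) \<cdot> a = (k \<cdot> x) \<cdot> f"
    using * assms(2,3,5) by (simp add: hom_def)
  ultimately show ?thesis using pushout_ex1[OF assms(1-3)] assms(4-7) by blast
qed

lemma pushout_arrows:
  assumes "is_pushout C f a x b"
  shows "x \<in> hom C (Cod C f) (Cod C x)" "b \<in> hom C (Cod C a) (Cod C x)" "b \<cdot> a = x \<cdot> f"
  using assms unfolding is_pushout_def hom_def by auto

text \<open>The uniqueness premise compares arrows along \<open>x\<close> alone. This asks for an
  epic \<open>x\<close>, which fits the intended case where \<open>x\<close> is a product
  projection.\<close>

lemma pushoutI:
  assumes "f \<in> hom C A X" "a \<in> hom C A B" "x \<in> hom C X Q" "b \<in> hom C B Q" "b \<cdot> a = x \<cdot> f"
    and "\<And>T u v. \<lbrakk>u \<in> hom C X T; v \<in> hom C B T; v \<cdot> a = u \<cdot> f\<rbrakk>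
           \<Longrightarrow> \<exists>h\<in>hom C Q T. h \<cdot> x = u \<and> h \<cdot> b = v"
    and "\<And>T h k. \<lbrakk>h \<in> hom C Q T; k \<in> hom C Q T; h \<cdot> x = k \<cdot> x\<rbrakk> \<Longrightarrow> h = k"
  shows "is_pushout C f a x b"
proof -
  have "\<exists>!h. h \<in> hom C Q T \<and> h \<cdot> x = u \<and> h \<cdot> b = v"
    if uv: "u \<in> hom C X T" "v \<in> hom C B T" "v \<cdot> a = u \<cdot> f" for T u v
  proof -
    obtain h where h: "h \<in> hom C Q T" "h \<cdot> x = u" "h \<cdot> b = v" using assms(6)[OF uv] by blast
    show ?thesis
    proof (rule ex1I[of _ h])
      fix k assume "k \<in> hom C Q T \<and> k \<cdot> x = u \<and> k \<cdot> b = v"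
      then show "k = h" using h assms(7)[of k T h] by simp
    qed (use h in simp)
  qed
  moreover have "f \<in> Arr C" "a \<in> Arr C" "Dom C f = A" "Dom C a = A" "Cod C f = X" "Cod C a = B"
    "x \<in> Arr C" "b \<in> Arr C" "Dom C x = X" "Dom C b = B" "Cod C x = Q" "Cod C b = Q"
    using assms(1-4) by (auto simp: hom_def)
  ultimately show ?thesis using assms(5) unfolding is_pushout_def by simp
qed

lemma coequaliser_ex1:
  assumes "is_coequaliser C r0 r1 e" "e \<in> hom C Y X" "u \<in> hom C Y T" "u \<cdot> r0 = u \<cdot> r1"
  shows "\<exists>!h. h \<in> hom C X T \<and> h \<cdot> e = u"
proof -
  have eqs: "Dom C e = Y" "Cod C e = X"
    using assms(2) by (auto simp: hom_def)
  have "\<forall>T\<in>Obj C. \<forall>u \<in> hom C (Dom C e) T. u \<cdot> r0 = u \<cdot> r1 \<longrightarrow>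
        (\<exists>!h. h \<in> hom C (Cod C e) T \<and> h \<cdot> e = u)"
    using assms(1) unfolding is_coequaliser_def by (elim conjE)
  then show ?thesis
    unfolding eqs using assms(3,4) hom_cod_obj[OF assms(3)] by blast
qed

lemma coequaliser_factor:
  assumes "is_coequaliser C r0 r1 e" "e \<in> hom C Y X" "u \<in> hom C Y T" "u \<cdot> r0 = u \<cdot> r1"
  obtains h where "h \<in> hom C X T" "h \<cdot> e = u"
  using coequaliser_ex1[OF assms] that by blast

lemma coequaliser_arrows:
  assumes "is_coequaliser C r0 r1 e" "e \<in> hom C Y X"
  shows "r0 \<in> hom C (Dom C r0) Y" "r1 \<in> hom C (Dom C r0) Y" "e \<cdot> r0 = e \<cdot> r1"
  using assms unfolding is_coequaliser_def hom_def by auto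

section \<open>Regular epimorphisms and descent along them\<close>

lemma regular_epi_cancel:
  assumes "regular_epi C e" "e \<in> hom C Y X" "h \<in> hom C X T" "k \<in> hom C X T" "h \<cdot> e = k \<cdot> e"
  shows "h = k"
proof -
  obtain r0 r1 where r: "is_coequaliser C r0 r1 e" using assms(1) unfolding regular_epi_def by blast
  note c = coequaliser_arrows[OF r assms(2)]
  have "k \<cdot> e \<in> hom C Y T" using assms by (auto simp: hom_def)
  moreover have "(k \<cdot> e) \<cdot> r0 = (k \<cdot> e) \<cdot> r1" using c assms by (simp add: hom_def)
  ultimately show ?thesis using coequaliser_ex1[OF r assms(2)] assms(3-5) by blast
qed

text \<open>The last premise ranges over all pairs that \<open>e\<close> identifies, so that one
  argues about arbitrary generalised elements instead of the unknown pair that \<open>e\<close>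
  coequalises.\<close>

lemma regular_epi_factor:
  assumes "regular_epi C e" "e \<in> hom C Y X" "u \<in> hom C Y T"
    and "\<And>Q c0 c1. \<lbrakk>c0 \<in> hom C Q Y; c1 \<in> hom C Q Y; e \<cdot> c0 = e \<cdot> c1\<rbrakk> \<Longrightarrow> u \<cdot> c0 = u \<cdot> c1"
  obtains h where "h \<in> hom C X T" "h \<cdot> e = u"
proof -
  obtain c0 c1 where c: "is_coequaliser C c0 c1 e"
    using assms(1) unfolding regular_epi_def by blast
  have "u \<cdot> c0 = u \<cdot> c1" using assms(4) coequaliser_arrows[OF c assms(2)] by blast
  then show ?thesis using coequaliser_factor[OF c assms(2,3)] that by blast
qed

text \<open>Regular epimorphisms are orthogonal to jointly monic pairs: a pair identified by
  \<open>e\<close> is identified by \<open>r0 \<cdot> k\<close> and \<open>r1 \<cdot> k\<close>,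
  hence by \<open>k\<close>, so \<open>k\<close> factors through \<open>e\<close>. This turns an
  arrow built on a cover \<open>S\<close> of \<open>T\<close> into one on \<open>T\<close>.\<close>

lemma fill_in:
  assumes "regular_epi C e" "e \<in> hom C S T" "k \<in> hom C S Z"
    and "r0 \<in> hom C Z A" "r1 \<in> hom C Z B" "u \<in> hom C T A" "v \<in> hom C T B"
    and "r0 \<cdot> k = u \<cdot> e" "r1 \<cdot> k = v \<cdot> e"
    and monic: "\<And>T h k. \<lbrakk>h \<in> hom C T Z; k \<in> hom C T Z; r0 \<cdot> h = r0 \<cdot> k; r1 \<cdot> h = r1 \<cdot> k\<rbrakk> \<Longrightarrow> h = k"
  shows "\<exists>t\<in>hom C T Z. r0 \<cdot> t = u \<and> r1 \<cdot> t = v"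
proof -
  note ex = assms(8)[THEN comp_eq_comp] assms(9)[THEN comp_eq_comp]
  have "k \<cdot> c0 = k \<cdot> c1" if "c0 \<in> hom C Q S" "c1 \<in> hom C Q S" "e \<cdot> c0 = e \<cdot> c1" for Q c0 c1
    by (rule monic[of _ Q]) (use that assms(2-7) in \<open>simp_all add: hom_def ex\<close>)
  then obtain t where t: "t \<in> hom C T Z" "t \<cdot> e = k"
    using regular_epi_factor[OF assms(1-3)] by blast
  have "r0 \<cdot> t = u"
    by (rule regular_epi_cancel[OF assms(1,2), of _ A]) (use t assms in \<open>simp_all add: hom_def\<close>)
  moreover have "r1 \<cdot> t = v"
    by (rule regular_epi_cancel[OF assms(1,2), of _ B]) (use t assms in \<open>simp_all add: hom_def\<close>)
  ultimately show ?thesis using t by blast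
qed

lemma kernel_pair_eqI:
  assumes "is_kernel_pair C e r0 r1" "r0 \<in> hom C R Y" "r1 \<in> hom C R Y"
    and "h \<in> hom C T R" "k \<in> hom C T R" "r0 \<cdot> h = r0 \<cdot> k" "r1 \<cdot> h = r1 \<cdot> k"
  shows "h = k"
  using pullback_eqI assms unfolding is_kernel_pair_def by metis

lemma kernel_pair_lift:
  assumes "is_kernel_pair C e r0 r1" "r0 \<in> hom C R Y" "r1 \<in> hom C R Y"
    and "u \<in> hom C T Y" "v \<in> hom C T Y" "e \<cdot> u = e \<cdot> v"
  obtains h where "h \<in> hom C T R" "r0 \<cdot> h = u" "r1 \<cdot> h = v"
  using pullback_lift assms unfolding is_kernel_pair_def by metis

text \<open>Interchange of four factors: \<open>Y\<close> is
  \<open>(A1 \<times> A2) \<times> (X1 \<times> X2)\<close>, regrouped as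
  \<open>(A1 \<times> X1) \<times> (A2 \<times> X2)\<close>, with \<open>y1 = a1 \<times> x1\<close>
  and \<open>y2 = a2 \<times> x2\<close>.\<close>

lemma product_interchange:
  assumes a: "is_product_diagram C a1 a2" "a1 \<in> hom C A A1" "a2 \<in> hom C A A2"
    and x: "is_product_diagram C x1 x2" "x1 \<in> hom C X X1" "x2 \<in> hom C X X2"
    and p: "is_product_diagram C p e" "p \<in> hom C Y A" "e \<in> hom C Y X"
    and p1: "is_product_diagram C p1 e1" "p1 \<in> hom C Y1 A1" "e1 \<in> hom C Y1 X1"
    and p2: "is_product_diagram C p2 e2" "p2 \<in> hom C Y2 A2" "e2 \<in> hom C Y2 X2"
    and y: "y1 \<in> hom C Y Y1" "y2 \<in> hom C Y Y2"
    and sq: "p1 \<cdot> y1 = a1 \<cdot> p" "e1 \<cdot> y1 = x1 \<cdot> e" "p2 \<cdot> y2 = a2 \<cdot> p" "e2 \<cdot> y2 = x2 \<cdot> e"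
  shows "is_product_diagram C y1 y2"
proof (rule product_diagramI[OF y])
  note sqs = sq[THEN comp_eq_comp]
  fix T u v assume uv: "u \<in> hom C T Y1" "v \<in> hom C T Y2"
  have "p1 \<cdot> u \<in> hom C T A1" "p2 \<cdot> v \<in> hom C T A2" "e1 \<cdot> u \<in> hom C T X1" "e2 \<cdot> v \<in> hom C T X2"
    using uv p1 p2 by (auto simp: hom_def)
  then obtain b c where b: "b \<in> hom C T A" "a1 \<cdot> b = p1 \<cdot> u" "a2 \<cdot> b = p2 \<cdot> v"
    and c: "c \<in> hom C T X" "x1 \<cdot> c = e1 \<cdot> u" "x2 \<cdot> c = e2 \<cdot> v"
    using product_lift[OF a] product_lift[OF x] by metis
  obtain h where h: "h \<in> hom C T Y" "p \<cdot> h = b" "e \<cdot> h = c" using product_lift[OF p b(1) c(1)] .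
  have "y1 \<cdot> h = u"
    by (rule product_eqI[OF p1, of _ T])
      (use h b c uv a(2) x(2) p(2,3) p1(2,3) y in \<open>simp_all add: hom_def sqs\<close>)
  moreover have "y2 \<cdot> h = v"
    by (rule product_eqI[OF p2, of _ T])
      (use h b c uv a(3) x(3) p(2,3) p2(2,3) y in \<open>simp_all add: hom_def sqs\<close>)
  ultimately show "\<exists>h\<in>hom C T Y. y1 \<cdot> h = u \<and> y2 \<cdot> h = v" using h by blast
next
  fix T h k assume hk: "h \<in> hom C T Y" "k \<in> hom C T Y" "y1 \<cdot> h = y1 \<cdot> k" "y2 \<cdot> h = y2 \<cdot> k"
  have ph: "(p1 \<cdot> y1) \<cdot> h = (p1 \<cdot> y1) \<cdot> k" "(p2 \<cdot> y2) \<cdot> h = (p2 \<cdot> y2) \<cdot> k"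
    "(e1 \<cdot> y1) \<cdot> h = (e1 \<cdot> y1) \<cdot> k" "(e2 \<cdot> y2) \<cdot> h = (e2 \<cdot> y2) \<cdot> k"
    using hk y p1(2,3) p2(2,3) by (simp_all add: hom_def)
  have "p \<cdot> h = p \<cdot> k"
    by (rule product_eqI[OF a, of _ T])
      (use ph[unfolded sq] hk(1,2) a(2,3) p(2,3) in \<open>simp_all add: hom_def\<close>)
  moreover have "e \<cdot> h = e \<cdot> k"
    by (rule product_eqI[OF x, of _ T])
      (use ph[unfolded sq] hk(1,2) x(2,3) p(2,3) in \<open>simp_all add: hom_def\<close>)
  ultimately show "h = k" using product_eqI[OF p hk(1,2)] by blast
qed

text \<open>A regular epimorphism is the coequaliser of its own kernel pair, because every pair that
  \<open>e\<close> identifies factors through \<open>r0, r1\<close>.\<close>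

lemma regular_epi_kernel_pair_factor:
  assumes "regular_epi C e" "e \<in> hom C Y X"
    and r: "is_kernel_pair C e r0 r1" "r0 \<in> hom C R Y" "r1 \<in> hom C R Y"
    and u: "u \<in> hom C Y T" "u \<cdot> r0 = u \<cdot> r1"
  obtains h where "h \<in> hom C X T" "h \<cdot> e = u"
proof (rule regular_epi_factor[OF assms(1,2) u(1)])
  fix Q c0 c1 assume c: "c0 \<in> hom C Q Y" "c1 \<in> hom C Q Y" "e \<cdot> c0 = e \<cdot> c1"
  then obtain m where m: "m \<in> hom C Q R" "r0 \<cdot> m = c0" "r1 \<cdot> m = c1"
    using kernel_pair_lift[OF r] by blast
  have "(u \<cdot> r0) \<cdot> m = (u \<cdot> r1) \<cdot> m" using u(2) by simp
  then show "u \<cdot> c0 = u \<cdot> c1" using m r(2,3) u(1) by (simp add: hom_def)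
qed (use that in blast)

text \<open>Transitivity is stated for arbitrary composable generalised elements; the projections of
  a pullback of \<open>r1\<close> and \<open>r0\<close> are one such pair.\<close>

lemma equivalence_relationI:
  assumes "r0 \<in> hom C R Y" "r1 \<in> hom C R Y"
    and "\<And>T h k. \<lbrakk>h \<in> hom C T R; k \<in> hom C T R; r0 \<cdot> h = r0 \<cdot> k; r1 \<cdot> h = r1 \<cdot> k\<rbrakk> \<Longrightarrow> h = k"
    and "\<exists>d\<in>hom C Y R. r0 \<cdot> d = Id C Y \<and> r1 \<cdot> d = Id C Y"
    and "\<exists>s\<in>hom C R R. r0 \<cdot> s = r1 \<and> r1 \<cdot> s = r0"
    and "\<And>P p q. \<lbrakk>p \<in> hom C P R; q \<in> hom C P R; r1 \<cdot> p = r0 \<cdot> q\<rbrakk>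
           \<Longrightarrow> \<exists>t\<in>hom C P R. r0 \<cdot> t = r0 \<cdot> p \<and> r1 \<cdot> t = r1 \<cdot> q"
  shows "equivalence_relation C r0 r1"
proof -
  have eqs: "Dom C r0 = R" "Dom C r1 = R" "Cod C r0 = Y" "Cod C r1 = Y" "r0 \<in> Arr C" "r1 \<in> Arr C"
    using assms(1,2) by (auto simp: hom_def)
  have "\<exists>t\<in>hom C (Dom C p) R. r0 \<cdot> t = r0 \<cdot> p \<and> r1 \<cdot> t = r1 \<cdot> q"
    if "is_pullback C r1 r0 p q" for p q
    using assms(6) pullback_arrows[OF that] unfolding eqs by blast
  moreover have "jointly_monic C r0 r1"
    unfolding jointly_monic_def eqs using assms(3) by blast
  ultimately show ?thesis
    unfolding equivalence_relation_def eqs using assms(4,5) eqs(5,6) by simp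
qed

lemma pushout_unique:
  assumes "is_pushout C f a x b" "is_pushout C f a x' b'"
  obtains i j where "i \<in> hom C (Cod C x) (Cod C x')" "j \<in> hom C (Cod C x') (Cod C x)"
    "i \<cdot> x = x'" "j \<cdot> x' = x" "i \<cdot> j = Id C (Cod C x')" "j \<cdot> i = Id C (Cod C x)"
proof -
  note m = pushout_arrows[OF assms(1)] and m' = pushout_arrows[OF assms(2)]
  obtain i where i: "i \<in> hom C (Cod C x) (Cod C x')" "i \<cdot> x = x'" "i \<cdot> b = b'"
    using pushout_factor[OF assms(1) m(1,2) m'(1,2,3)] .
  obtain j where j: "j \<in> hom C (Cod C x') (Cod C x)" "j \<cdot> x' = x" "j \<cdot> b' = b"
    using pushout_factor[OF assms(2) m'(1,2) m(1,2,3)] .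
  have "j \<cdot> i = Id C (Cod C x)"
    by (rule pushout_eqI[OF assms(1) m(1,2)]) (use i j m(1,2) m'(1,2) in \<open>auto simp: hom_def\<close>)
  moreover have "i \<cdot> j = Id C (Cod C x')"
    by (rule pushout_eqI[OF assms(2) m'(1,2)]) (use i j m(1,2) m'(1,2) in \<open>auto simp: hom_def\<close>)
  ultimately show ?thesis using that i j by blast
qed

text \<open>(C1) speaks about every choice of pushouts; this carries the product property from one
  choice to any other.\<close>

lemma product_diagram_iso:
  assumes x: "is_product_diagram C x1 x2" "x1 \<in> hom C X X1" "x2 \<in> hom C X X2"
    and i1: "i1 \<in> hom C X1 X1'" "j1 \<in> hom C X1' X1" "i1 \<cdot> j1 = Id C X1'" "j1 \<cdot> i1 = Id C X1"
    and i2: "i2 \<in> hom C X2 X2'" "j2 \<in> hom C X2' X2" "i2 \<cdot> j2 = Id C X2'" "j2 \<cdot> i2 = Id C X2"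
  shows "is_product_diagram C (i1 \<cdot> x1) (i2 \<cdot> x2)"
proof (rule product_diagramI)
  note ij = i1(3,4)[THEN comp_eq_comp] i2(3,4)[THEN comp_eq_comp]
  show "i1 \<cdot> x1 \<in> hom C X X1'" "i2 \<cdot> x2 \<in> hom C X X2'" using assms by (auto simp: hom_def)
  show "\<exists>h\<in>hom C T X. (i1 \<cdot> x1) \<cdot> h = u \<and> (i2 \<cdot> x2) \<cdot> h = v"
    if uv: "u \<in> hom C T X1'" "v \<in> hom C T X2'" for T u v
  proof -
    have "j1 \<cdot> u \<in> hom C T X1" "j2 \<cdot> v \<in> hom C T X2" using uv i1 i2 by (auto simp: hom_def)
    then obtain h where "h \<in> hom C T X" "x1 \<cdot> h = j1 \<cdot> u" "x2 \<cdot> h = j2 \<cdot> v"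
      using product_lift[OF x] by blast
    then show ?thesis using uv x(2,3) i1(1,2) i2(1,2) ij
      by (intro bexI[of _ h]) (simp_all add: hom_def)
  qed
  show "h = k" if hk: "h \<in> hom C T X" "k \<in> hom C T X" "(i1 \<cdot> x1) \<cdot> h = (i1 \<cdot> x1) \<cdot> k"
    "(i2 \<cdot> x2) \<cdot> h = (i2 \<cdot> x2) \<cdot> k" for T h k
  proof (rule product_eqI[OF x hk(1,2)])
    have "j1 \<cdot> ((i1 \<cdot> x1) \<cdot> h) = j1 \<cdot> ((i1 \<cdot> x1) \<cdot> k)" "j2 \<cdot> ((i2 \<cdot> x2) \<cdot> h) = j2 \<cdot> ((i2 \<cdot> x2) \<cdot> k)"
      using hk by simp_all
    then show "x1 \<cdot> h = x1 \<cdot> k" "x2 \<cdot> h = x2 \<cdot> k"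
      using hk(1,2) x(2,3) i1(1,2) i2(1,2) by (simp_all add: hom_def ij)
  qed
qed

end

section \<open>Terminal object, pullbacks and products from finite limits\<close>

lemma has_terminal_object:
  fixes C :: "('o, 'm) cat"
  assumes "has_finite_limits C"
  obtains E where "E \<in> Obj C" "\<And>T. T \<in> Obj C \<Longrightarrow> \<exists>!h. h \<in> hom C T E"
proof -
  define J :: "(nat, nat) cat" where
    "J = \<lparr>Obj = {}, Arr = {}, Dom = id, Cod = id, Id = id, Comp = (\<lambda>g f. f)\<rparr>"
  have "finite_category J"
    by (simp add: finite_category_def category_def J_def)
  moreover have "is_functor J C Fo Fm" for Fo Fm
    by (simp add: is_functor_def J_def)
  ultimately obtain E p where "is_limit J C (\<lambda>_. undefined) (\<lambda>_. undefined) E p"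
    using assms unfolding has_finite_limits_def has_limits_of_shape_def by blast
  then show ?thesis
    using that by (auto simp: is_limit_def is_cone_def J_def)
qed

lemma (in category) has_pullback:
  assumes fin: "has_finite_limits C" and f: "f \<in> hom C A X" and g: "g \<in> hom C B X"
  obtains P p q where "p \<in> hom C P A" "q \<in> hom C P B" "is_pullback C f g p q"
proof -
  \<comment> \<open>The cospan shape: \<open>0\<close>, \<open>1\<close>, \<open>2\<close> are the
    objects and also their identities, with \<open>3 : 0 \<rightarrow> 2\<close> and
    \<open>4 : 1 \<rightarrow> 2\<close>. In a composable pair with \<open>v\<close> at least
    \<open>3\<close> the factor \<open>u\<close> is an identity, whence the rule for
    \<open>Comp\<close>.\<close>
  define J :: "(nat, nat) cat" where
    "J = \<lparr>Obj = {0, 1, 2}, Arr = {0, 1, 2, 3, 4}, Dom = id(3 := 0, 4 := 1),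
          Cod = id(3 := 2, 4 := 2), Id = id, Comp = (\<lambda>v u. if v < 3 then u else v)\<rparr>"
  define Fo where "Fo = (\<lambda>j::nat. if j = 0 then A else if j = 1 then B else X)"
  define Fm where "Fm = (\<lambda>u::nat. if u = 3 then f else if u = 4 then g else Id C (Fo u))"
  have J: "Obj J = {0, 1, 2}" "Arr J = {0, 1, 2, 3, 4}" "Dom J = id(3 := 0, 4 := 1)"
    "Cod J = id(3 := 2, 4 := 2)" "Id J = id" "\<And>v u. v \<cdot>\<^bsub>J\<^esub> u = (if v < 3 then u else v)"
    by (simp_all add: J_def)
  have ar: "f \<in> Arr C" "Dom C f = A" "Cod C f = X" "g \<in> Arr C" "Dom C g = B" "Cod C g = X"
    using f g by (auto simp: hom_def)
  have ob: "A \<in> Obj C" "B \<in> Obj C" "X \<in> Obj C" using f g hom_dom_obj hom_cod_obj by blast+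
  have "category J"
    by unfold_locales (auto simp: J hom_def split: if_splits)
  then have "finite_category J" by (simp add: finite_category_def J)
  moreover have "is_functor J C Fo Fm"
    unfolding is_functor_def using ar ob by (auto simp: J Fo_def Fm_def hom_def)
  ultimately obtain P p where lim: "is_limit J C Fo Fm P p"
    using fin unfolding has_finite_limits_def has_limits_of_shape_def by blast
  then have cone: "is_cone J C Fo Fm P p" by (simp add: is_limit_def)
  have p: "p 0 \<in> hom C P A" "p 1 \<in> hom C P B" "p 2 \<in> hom C P X" "f \<cdot> p 0 = p 2" "g \<cdot> p 1 = p 2"
    using cone unfolding is_cone_def by (auto simp: J Fo_def Fm_def)
  \<comment> \<open>The leg at \<open>2\<close> is forced by the other two, so cones amount to
    commuting squares over \<open>f\<close> and \<open>g\<close>.\<close>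
  have cone_iff: "is_cone J C Fo Fm T t \<longleftrightarrow>
      t 0 \<in> hom C T A \<and> t 1 \<in> hom C T B \<and> t 2 = f \<cdot> t 0 \<and> t 2 = g \<cdot> t 1" for T t
    using ar ob hom_dom_obj[of "t 0" T A] by (auto simp: is_cone_def J Fo_def Fm_def hom_def)
  have lift: "\<exists>!h. h \<in> hom C T P \<and> p 0 \<cdot> h = u \<and> p 1 \<cdot> h = v"
    if uv: "u \<in> hom C T A" "v \<in> hom C T B" "f \<cdot> u = g \<cdot> v" for T u v
  proof -
    define t where "t = (\<lambda>j::nat. if j = 0 then u else if j = 1 then v else f \<cdot> u)"
    have "is_cone J C Fo Fm T t" using uv by (simp add: cone_iff t_def)
    then have ex: "\<exists>!h. h \<in> hom C T P \<and> (\<forall>j\<in>Obj J. p j \<cdot> h = t j)"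
      using lim unfolding is_limit_def by blast
    have "p 2 \<cdot> h = f \<cdot> u" if h: "h \<in> hom C T P" "p 0 \<cdot> h = u" for h
    proof -
      have "p 2 \<cdot> h = (f \<cdot> p 0) \<cdot> h" by (simp only: p(4))
      also have "\<dots> = f \<cdot> u" using p(1) h ar by (simp add: hom_def)
      finally show ?thesis .
    qed
    then have "(h \<in> hom C T P \<and> (\<forall>j\<in>Obj J. p j \<cdot> h = t j)) \<longleftrightarrow>
        h \<in> hom C T P \<and> p 0 \<cdot> h = u \<and> p 1 \<cdot> h = v" for h
      by (auto simp: J t_def)
    with ex show ?thesis by simp
  qed
  have "is_pullback C f g (p 0) (p 1)"
  proof (rule pullbackI[OF f g p(1,2)])
    show "f \<cdot> p 0 = g \<cdot> p 1" using p by simp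
    show "\<exists>h\<in>hom C T P. p 0 \<cdot> h = u \<and> p 1 \<cdot> h = v"
      if "u \<in> hom C T A" "v \<in> hom C T B" "f \<cdot> u = g \<cdot> v" for T u v
      using lift[OF that] by blast
    show "h = k" if "h \<in> hom C T P" "k \<in> hom C T P" "p 0 \<cdot> h = p 0 \<cdot> k" "p 1 \<cdot> h = p 1 \<cdot> k" for T h k
    proof -
      have "f \<cdot> (p 0 \<cdot> k) = g \<cdot> (p 1 \<cdot> k)"
        using p ar that comp_eq_comp[OF p(4)] comp_eq_comp[OF p(5)] by (simp add: hom_def)
      moreover have "p 0 \<cdot> k \<in> hom C T A" "p 1 \<cdot> k \<in> hom C T B" using p that by (auto simp: hom_def)
      ultimately show "h = k" using lift that by blast
    qed
  qed
  then show ?thesis using that p by blast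
qed

section \<open>Product projections are regular epimorphisms\<close>

locale split_coextensive_exact = category C for C :: "('o, 'm) cat" (structure) +
  assumes exact: "barr_exact C"
    and split: "split_mono C f \<Longrightarrow> coextensive_morphism C f"
begin

lemma finite_limits: "has_finite_limits C"
  using exact by (simp add: barr_exact_def regular_category_def)

lemmas pullback_exists = has_pullback[OF finite_limits]

lemma kernel_pair_exists:
  assumes "e \<in> hom C Y X"
  obtains R r0 r1 where "r0 \<in> hom C R Y" "r1 \<in> hom C R Y" "is_kernel_pair C e r0 r1"
  using pullback_exists[OF assms assms] unfolding is_kernel_pair_def by blast

lemma kernel_pair_coequaliser:
  assumes "is_kernel_pair C f r0 r1"
  obtains e where "is_coequaliser C r0 r1 e"
  using assms exact unfolding barr_exact_def regular_category_def by blast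

lemma regular_epi_pullback:
  assumes "regular_epi C e" "is_pullback C e g p q"
  shows "regular_epi C q"
proof -
  have "\<forall>e g p q. regular_epi C e \<and> is_pullback C e g p q \<longrightarrow> regular_epi C q"
    using exact unfolding barr_exact_def regular_category_def by (elim conjE)
  then show ?thesis using assms by blast
qed

text \<open>Pull \<open>e\<close> back along \<open>u\<close>. A generalised element of
  \<open>X\<close> thus lifts to \<open>Y\<close> after its stage \<open>T\<close> is replaced by a
  cover \<open>S\<close>, as elements lift along a surjection.\<close>

lemma cover_lift:
  assumes "regular_epi C e" "e \<in> hom C Y X" "u \<in> hom C T X"
  obtains S c w where "regular_epi C c" "c \<in> hom C S T" "w \<in> hom C S Y" "e \<cdot> w = u \<cdot> c"
proof -
  obtain S w c where *: "w \<in> hom C S Y" "c \<in> hom C S T" "is_pullback C e u w c"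
    using pullback_exists[OF assms(2,3)] by blast
  then have "regular_epi C c" using regular_epi_pullback assms by blast
  then show ?thesis using * that pullback_arrows(5) by blast
qed

definition terminal :: 'o where
  "terminal = (SOME E. E \<in> Obj C \<and> (\<forall>T\<in>Obj C. \<exists>!h. h \<in> hom C T E))"

lemma terminal_ex1: "T \<in> Obj C \<Longrightarrow> \<exists>!h. h \<in> hom C T terminal"
proof -
  have "\<exists>E. E \<in> Obj C \<and> (\<forall>T\<in>Obj C. \<exists>!h. h \<in> hom C T E)"
    using has_terminal_object[OF finite_limits] by metis
  then have "terminal \<in> Obj C \<and> (\<forall>T\<in>Obj C. \<exists>!h. h \<in> hom C T terminal)"
    unfolding terminal_def by (rule someI_ex)
  then show "T \<in> Obj C \<Longrightarrow> \<exists>!h. h \<in> hom C T terminal" by blast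
qed

lemma terminal_arr:
  assumes "T \<in> Obj C"
  obtains h where "h \<in> hom C T terminal"
  using terminal_ex1[OF assms] by blast

lemma terminal_eq: "h \<in> hom C T terminal \<Longrightarrow> k \<in> hom C T terminal \<Longrightarrow> h = k"
  using terminal_ex1[of T] hom_dom_obj[of h T] by blast

text \<open>A product is a pullback over the terminal object, where the commuting condition holds
  automatically.\<close>

lemma product_exists:
  assumes "A \<in> Obj C" "B \<in> Obj C"
  obtains P p q where "p \<in> hom C P A" "q \<in> hom C P B" "is_product_diagram C p q"
proof -
  obtain f where f: "f \<in> hom C A terminal" using terminal_arr assms by blast
  obtain g where g: "g \<in> hom C B terminal" using terminal_arr assms by blast
  obtain P p q where p: "p \<in> hom C P A" "q \<in> hom C P B" "is_pullback C f g p q"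
    using pullback_exists[OF f g] by blast
  have "is_product_diagram C p q"
  proof (rule product_diagramI[OF p(1,2)])
    fix T u v assume uv: "u \<in> hom C T A" "v \<in> hom C T B"
    have "f \<cdot> u = g \<cdot> v"
      by (rule terminal_eq[of _ T]) (use f g uv in \<open>auto simp: hom_def\<close>)
    then show "\<exists>h\<in>hom C T P. p \<cdot> h = u \<and> q \<cdot> h = v" using pullback_lift[OF p(3,1,2) uv] by blast
  qed (use pullback_eqI[OF p(3,1,2)] in blast)
  then show ?thesis using that p by blast
qed

text \<open>If \<open>I\<close> is subterminal then both \<open>I \<leftarrow> I \<rightarrow> I\<close> and \<open>I \<leftarrow> I \<rightarrow> 1\<close> are products; (C2) for the
  identity of \<open>I\<close> makes \<open>I \<rightarrow> 1\<close> a pushout of an identity.\<close>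

lemma subterminal_inhabited:
  assumes I: "I \<in> Obj C" and sub: "\<And>T h k. h \<in> hom C T I \<Longrightarrow> k \<in> hom C T I \<Longrightarrow> h = k"
  obtains h where "h \<in> hom C terminal I"
proof -
  obtain t where t: "t \<in> hom C I terminal" using terminal_arr I by blast
  have "split_mono C (Id C I)" using I id_hom[OF I] by (auto simp: split_mono_def intro!: bexI[of _ "Id C I"])
  then have c2: "coextensive_C2 C (Id C I)" using split by (simp add: coextensive_morphism_def)
  have p: "is_product_diagram C (Id C I) (Id C I)"
    by (rule product_diagramI[of _ I I _ I]) (use sub id_hom[OF I] in \<open>auto simp: hom_def\<close>)
  have q: "is_product_diagram C (Id C I) t"
    by (rule product_diagramI[of _ I I _ terminal])
      (use sub t id_hom[OF I] terminal_eq in \<open>auto simp: hom_def\<close>)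
  have "is_pushout C (Id C I) (Id C I) t t"
    by (rule c2[unfolded coextensive_C2_def, rule_format, of "Id C I" "Id C I" "Id C I" t "Id C I" t, THEN conjunct2])
      (use p q I t id_hom[OF I] in \<open>auto simp: hom_def\<close>)
  \<comment> \<open>The cocone consisting of two identities of \<open>I\<close> factors through the
    pushout object \<open>terminal\<close>, and the factor is the required arrow.\<close>
  from pushout_factor[OF this t t id_hom[OF I] id_hom[OF I]] show ?thesis using that by blast
qed

text \<open>Let \<open>I\<close> be the image of \<open>B \<rightarrow> 1\<close>. It is
  subterminal, so it has an arrow from \<open>1\<close>, and \<open>p\<close> is the pullback of the
  regular epimorphism \<open>B \<rightarrow> I\<close> along
  \<open>A \<rightarrow> 1 \<rightarrow> I\<close>.\<close>

lemma product_fst_regular_epi: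
  assumes pq: "is_product_diagram C p q" "p \<in> hom C P A" "q \<in> hom C P B"
  shows "regular_epi C p"
proof -
  have B: "B \<in> Obj C" using pq hom_cod_obj by blast
  obtain t where t: "t \<in> hom C B terminal" using terminal_arr B by blast
  obtain R r0 r1 where r: "r0 \<in> hom C R B" "r1 \<in> hom C R B" "is_kernel_pair C t r0 r1"
    using kernel_pair_exists[OF t] by blast
  obtain e where co: "is_coequaliser C r0 r1 e" using kernel_pair_coequaliser[OF r(3)] by blast
  define I where "I = Cod C e"
  have e: "e \<in> hom C B I" using co r by (auto simp: is_coequaliser_def hom_def I_def)
  have re: "regular_epi C e" using co unfolding regular_epi_def by blast
  \<comment> \<open>On a common cover \<open>S'\<close> both \<open>h\<close> and \<open>k\<close>
    lift to \<open>B\<close>. Any two generalised elements of \<open>B\<close> are related by the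
    kernel pair of \<open>B \<rightarrow> 1\<close>, so \<open>e\<close> identifies the
    lifts.\<close>
  have sub: "h = k" if h: "h \<in> hom C T I" and k: "k \<in> hom C T I" for T h k
  proof -
    obtain S c w where c: "regular_epi C c" "c \<in> hom C S T" "w \<in> hom C S B" "e \<cdot> w = h \<cdot> c"
      using cover_lift[OF re e h] by blast
    have "k \<cdot> c \<in> hom C S I" using c k by (auto simp: hom_def)
    then obtain S' c' w' where c': "regular_epi C c'" "c' \<in> hom C S' S" "w' \<in> hom C S' B"
      "e \<cdot> w' = (k \<cdot> c) \<cdot> c'"
      using cover_lift[OF re e] by blast
    have wc: "w \<cdot> c' \<in> hom C S' B" using c c' by (auto simp: hom_def)
    have "t \<cdot> (w \<cdot> c') = t \<cdot> w'"
      by (rule terminal_eq[of _ S']) (use t wc c' in \<open>auto simp: hom_def\<close>)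
    then obtain m where m: "m \<in> hom C S' R" "r0 \<cdot> m = w \<cdot> c'" "r1 \<cdot> m = w'"
      using kernel_pair_lift[OF r(3,1,2) wc c'(3)] by blast
    have "(e \<cdot> r0) \<cdot> m = (e \<cdot> r1) \<cdot> m" using coequaliser_arrows(3)[OF co e] by simp
    then have "e \<cdot> (w \<cdot> c') = e \<cdot> w'" using m r(1,2) e by (simp add: hom_def)
    moreover have "e \<cdot> (w \<cdot> c') = (e \<cdot> w) \<cdot> c'" using c(3) c'(2) e by (simp add: hom_def)
    ultimately have "(h \<cdot> c) \<cdot> c' = (k \<cdot> c) \<cdot> c'" by (simp only: c(4) c'(4))
    moreover have "h \<cdot> c \<in> hom C S I" "k \<cdot> c \<in> hom C S I" using c h k by (auto simp: hom_def)
    ultimately have "h \<cdot> c = k \<cdot> c" using regular_epi_cancel[OF c'(1,2)] by blast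
    then show "h = k" using regular_epi_cancel[OF c(1,2)] h k by blast
  qed
  have I: "I \<in> Obj C" using e hom_cod_obj by blast
  obtain i where i: "i \<in> hom C terminal I" using subterminal_inhabited[OF I] sub by metis
  have A: "A \<in> Obj C" using pq hom_cod_obj by blast
  obtain a where a: "a \<in> hom C A terminal" using terminal_arr A by blast
  have ia: "i \<cdot> a \<in> hom C A I" using i a by (auto simp: hom_def)
  \<comment> \<open>Over the subterminal \<open>I\<close> every square commutes, so this pullback
    has the universal property of the product.\<close>
  have "is_pullback C e (i \<cdot> a) q p"
  proof (rule pullbackI[OF e ia pq(3,2)])
    show "e \<cdot> q = (i \<cdot> a) \<cdot> p" by (rule sub[of _ P]) (use e ia i a pq in \<open>auto simp: hom_def\<close>)
    show "\<exists>h\<in>hom C T P. q \<cdot> h = u \<and> p \<cdot> h = v" if "u \<in> hom C T B" "v \<in> hom C T A" for T u v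
      using product_lift[OF pq that(2,1)] by blast
  qed (use product_eqI[OF pq] in blast)
  then show ?thesis using regular_epi_pullback[OF re] by blast
qed

lemma product_snd_regular_epi:
  assumes "is_product_diagram C p q" "p \<in> hom C P A" "q \<in> hom C P B"
  shows "regular_epi C q"
  using product_fst_regular_epi[OF product_swap[OF assms(1)] assms(3,2)] .

section \<open>Condition (C2)\<close>

text \<open>An equation between arrows out of \<open>A\<close> may be checked on the product of
  \<open>A\<close> with any object. The extra factor serves below to supply missing
  components.\<close>

lemma product_fst_cancel:
  assumes "is_product_diagram C p q" "p \<in> hom C P A" "q \<in> hom C P B"
    and "h \<in> hom C A T" "k \<in> hom C A T" "h \<cdot> p = k \<cdot> p"
  shows "h = k"
  using regular_epi_cancel[OF product_fst_regular_epi] assms by blast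

text \<open>\<open>g\<close> is the graph \<open>(1, f)\<close>, with retraction \<open>p\<close>;
  so (C1) and (C2) hold for \<open>g\<close> even when \<open>f\<close> itself has no
  retraction.\<close>

lemma graph_exists:
  assumes "f \<in> hom C A X"
  obtains Y p e g where "is_product_diagram C p e" "p \<in> hom C Y A" "e \<in> hom C Y X"
    "g \<in> hom C A Y" "p \<cdot> g = Id C A" "e \<cdot> g = f" "split_mono C g"
proof -
  have "A \<in> Obj C" "X \<in> Obj C" using assms hom_dom_obj hom_cod_obj by blast+
  then obtain Y p e where p: "p \<in> hom C Y A" "e \<in> hom C Y X" "is_product_diagram C p e"
    using product_exists by blast
  obtain g where g: "g \<in> hom C A Y" "p \<cdot> g = Id C A" "e \<cdot> g = f"
    using product_lift[OF p(3,1,2) id_hom[OF \<open>A \<in> Obj C\<close>] assms] .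
  moreover have "split_mono C g" using g p by (auto simp: split_mono_def hom_def)
  ultimately show ?thesis using that p by blast
qed

lemma split_mono_coextensive:
  assumes "split_mono C g"
  shows "coextensive_C1 C g" "coextensive_C2 C g"
  using split[OF assms] by (simp_all add: coextensive_morphism_def)

text \<open>(C2) applies to the graph \<open>g\<close> of \<open>f\<close>, since
  \<open>Y = A \<times> X\<close> decomposes into \<open>A1 \<times> X1\<close> and
  \<open>A2 \<times> X2\<close>. A cocone \<open>(u, v)\<close> on \<open>f\<close> yields the
  cocone \<open>(u \<cdot> e, v)\<close> on \<open>g\<close>; its factorisation \<open>k\<close>
  through \<open>Y1\<close> then descends along \<open>e1\<close> to \<open>X1\<close>.\<close>

lemma product_square_pushout:
  assumes a: "is_product_diagram C a1 a2" "a1 \<in> hom C A A1" "a2 \<in> hom C A A2"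
    and x: "is_product_diagram C x1 x2" "x1 \<in> hom C X X1" "x2 \<in> hom C X X2"
    and f: "f \<in> hom C A X" "f1 \<in> hom C A1 X1" "f2 \<in> hom C A2 X2"
    and sq: "f1 \<cdot> a1 = x1 \<cdot> f" "f2 \<cdot> a2 = x2 \<cdot> f"
  shows "is_pushout C f a1 x1 f1"
proof -
  obtain Y p e g where p: "is_product_diagram C p e" "p \<in> hom C Y A" "e \<in> hom C Y X"
    and g: "g \<in> hom C A Y" "p \<cdot> g = Id C A" "e \<cdot> g = f" "split_mono C g"
    using graph_exists[OF f(1)] .
  obtain Y1 p1 e1 g1 where p1: "is_product_diagram C p1 e1" "p1 \<in> hom C Y1 A1" "e1 \<in> hom C Y1 X1"
    and g1: "g1 \<in> hom C A1 Y1" "p1 \<cdot> g1 = Id C A1" "e1 \<cdot> g1 = f1"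
    using graph_exists[OF f(2)] .
  obtain Y2 p2 e2 g2 where p2: "is_product_diagram C p2 e2" "p2 \<in> hom C Y2 A2" "e2 \<in> hom C Y2 X2"
    and g2: "g2 \<in> hom C A2 Y2" "p2 \<cdot> g2 = Id C A2" "e2 \<cdot> g2 = f2"
    using graph_exists[OF f(3)] .
  \<comment> \<open>These composites are the components of \<open>y1 = a1 \<times> x1\<close> and
    \<open>y2 = a2 \<times> x2\<close>.\<close>
  have "a1 \<cdot> p \<in> hom C Y A1" "x1 \<cdot> e \<in> hom C Y X1" "a2 \<cdot> p \<in> hom C Y A2" "x2 \<cdot> e \<in> hom C Y X2"
    using a x p by (auto simp: hom_def)
  then obtain y1 y2 where y1: "y1 \<in> hom C Y Y1" "p1 \<cdot> y1 = a1 \<cdot> p" "e1 \<cdot> y1 = x1 \<cdot> e"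
    and y2: "y2 \<in> hom C Y Y2" "p2 \<cdot> y2 = a2 \<cdot> p" "e2 \<cdot> y2 = x2 \<cdot> e"
    using product_lift[OF p1] product_lift[OF p2] by metis
  have y: "is_product_diagram C y1 y2"
    using product_interchange[OF a x p p1 p2 y1(1) y2(1) y1(2,3) y2(2,3)] .
  have sq1: "g1 \<cdot> a1 = y1 \<cdot> g"
    by (rule product_eqI[OF p1, of _ A])
      (use a(2) x(2) p(2,3) g(1) p1(2,3) g1(1) y1(1) sq(1) f
        y1(2,3)[THEN comp_eq_comp] g1(2,3)[THEN comp_eq_comp] g(2,3) in \<open>simp_all add: hom_def\<close>)
  have sq2: "g2 \<cdot> a2 = y2 \<cdot> g"
    by (rule product_eqI[OF p2, of _ A])
      (use a(3) x(3) p(2,3) g(1) p2(2,3) g2(1) y2(1) sq(2) f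
        y2(2,3)[THEN comp_eq_comp] g2(2,3)[THEN comp_eq_comp] g(2,3) in \<open>simp_all add: hom_def\<close>)
  have po: "is_pushout C g a1 y1 g1"
    by (rule split_mono_coextensive(2)[OF g(4), unfolded coextensive_C2_def, rule_format,
          of a1 a2 y1 y2 g1 g2, THEN conjunct1])
      (use a y y1(1) y2(1) g(1) g1(1) g2(1) sq1 sq2 in \<open>auto simp: hom_def\<close>)
  show ?thesis
  proof (rule pushoutI[OF f(1) a(2) x(2) f(2) sq(1)])
    fix T u v assume uv: "u \<in> hom C X T" "v \<in> hom C A1 T" "v \<cdot> a1 = u \<cdot> f"
    have ue: "u \<cdot> e \<in> hom C Y T" using uv p by (auto simp: hom_def)
    have "v \<cdot> a1 = (u \<cdot> e) \<cdot> g" using uv p(3) g(1,3) by (simp add: hom_def)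
    then obtain k where k: "k \<in> hom C Y1 T" "k \<cdot> y1 = u \<cdot> e" "k \<cdot> g1 = v"
      using pushout_factor[OF po y1(1) g1(1) ue uv(2)] by blast
    obtain h where h: "h \<in> hom C X1 T" "h \<cdot> e1 = k"
    proof (rule regular_epi_factor[OF product_snd_regular_epi[OF p1] p1(3) k(1)])
      fix Q c0 c1 assume c: "c0 \<in> hom C Q Y1" "c1 \<in> hom C Q Y1" "e1 \<cdot> c0 = e1 \<cdot> c1"
      \<comment> \<open>Over the cover \<open>Q \<times> Y2\<close> of \<open>Q\<close>, extend
        \<open>c0\<close> and \<open>c1\<close> to elements \<open>w0\<close>, \<open>w1\<close> of
        \<open>Y\<close> with the same second component \<open>n\<close>. Then \<open>e\<close>
        identifies them, and \<open>k \<cdot> y1 = u \<cdot> e\<close> gives the claim on the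
        cover.\<close>
      have "Q \<in> Obj C" "Y2 \<in> Obj C" using c y2 hom_dom_obj hom_cod_obj by blast+
      then obtain S m n where m: "m \<in> hom C S Q" "n \<in> hom C S Y2" "is_product_diagram C m n"
        using product_exists by blast
      have cm: "c0 \<cdot> m \<in> hom C S Y1" "c1 \<cdot> m \<in> hom C S Y1" using c m by (auto simp: hom_def)
      obtain w0 where w0: "w0 \<in> hom C S Y" "y1 \<cdot> w0 = c0 \<cdot> m" "y2 \<cdot> w0 = n"
        using product_lift[OF y y1(1) y2(1) cm(1) m(2)] .
      obtain w1 where w1: "w1 \<in> hom C S Y" "y1 \<cdot> w1 = c1 \<cdot> m" "y2 \<cdot> w1 = n"
        using product_lift[OF y y1(1) y2(1) cm(2) m(2)] .
      have x1w: "x1 \<cdot> (e \<cdot> w) = e1 \<cdot> (y1 \<cdot> w)" and x2w: "x2 \<cdot> (e \<cdot> w) = e2 \<cdot> (y2 \<cdot> w)"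
        and kw: "k \<cdot> (y1 \<cdot> w) = u \<cdot> (e \<cdot> w)" if "w \<in> hom C S Y" for w
        using that x(2,3) p(3) p1(3) p2(3) y1(1) y2(1) k(1) uv(1)
          comp_eq_comp[OF y1(3)] comp_eq_comp[OF y2(3)] comp_eq_comp[OF k(2)]
        by (simp_all add: hom_def)
      have "e \<cdot> w0 = e \<cdot> w1"
      proof (rule product_eqI[OF x, of _ S])
        show "x1 \<cdot> (e \<cdot> w0) = x1 \<cdot> (e \<cdot> w1)"
          unfolding x1w[OF w0(1)] x1w[OF w1(1)] w0 w1
          using c m(1) p1(3) comp_eq_comp[OF c(3)] by (simp add: hom_def)
        show "x2 \<cdot> (e \<cdot> w0) = x2 \<cdot> (e \<cdot> w1)"
          unfolding x2w[OF w0(1)] x2w[OF w1(1)] w0 w1 ..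
      qed (use p(3) w0 w1 in \<open>auto simp: hom_def\<close>)
      then have "k \<cdot> (c0 \<cdot> m) = k \<cdot> (c1 \<cdot> m)"
        using kw[OF w0(1)] kw[OF w1(1)] w0 w1 by simp
      then have "(k \<cdot> c0) \<cdot> m = (k \<cdot> c1) \<cdot> m" using k c m by (simp add: hom_def)
      moreover have "k \<cdot> c0 \<in> hom C Q T" "k \<cdot> c1 \<in> hom C Q T" using k c by (auto simp: hom_def)
      ultimately show "k \<cdot> c0 = k \<cdot> c1" using product_fst_cancel[OF m(3,1,2)] by blast
    qed
    have "h \<cdot> x1 = u"
    proof (rule regular_epi_cancel[OF product_snd_regular_epi[OF p] p(3), of _ T])
      have "(h \<cdot> x1) \<cdot> e = h \<cdot> (e1 \<cdot> y1)" using y1(3) h(1) x(2) p(3) by (simp add: hom_def)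
      also have "\<dots> = (h \<cdot> e1) \<cdot> y1" using h(1) p1(3) y1(1) by (simp add: hom_def)
      finally show "(h \<cdot> x1) \<cdot> e = u \<cdot> e" using h(2) k(2) by simp
    qed (use h(1) x(2) uv in \<open>auto simp: hom_def\<close>)
    moreover have "h \<cdot> f1 = v"
    proof -
      have "h \<cdot> f1 = (h \<cdot> e1) \<cdot> g1" using h(1) p1(3) g1(1,3) by (simp add: hom_def)
      then show ?thesis using h(2) k(3) by simp
    qed
    ultimately show "\<exists>h\<in>hom C X1 T. h \<cdot> x1 = u \<and> h \<cdot> f1 = v" using h(1) by blast
  next
    fix T h k assume "h \<in> hom C X1 T" "k \<in> hom C X1 T" "h \<cdot> x1 = k \<cdot> x1"
    then show "h = k" using product_fst_cancel[OF x] by blast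
  qed
qed

lemma coextensive_C2:
  assumes f: "f \<in> Arr C"
  shows "coextensive_C2 C f"
  unfolding coextensive_C2_def
proof (intro allI impI, elim conjE)
  fix a1 a2 x1 x2 f1 f2
  assume a: "is_product_diagram C a1 a2" "Dom C a1 = Dom C f"
    and x: "is_product_diagram C x1 x2" "Dom C x1 = Cod C f"
    and fi: "f1 \<in> hom C (Cod C a1) (Cod C x1)" "f2 \<in> hom C (Cod C a2) (Cod C x2)"
    and sq: "f1 \<cdot> a1 = x1 \<cdot> f" "f2 \<cdot> a2 = x2 \<cdot> f"
  have ah: "a1 \<in> hom C (Dom C f) (Cod C a1)" "a2 \<in> hom C (Dom C f) (Cod C a2)"
    using a unfolding is_product_diagram_def hom_def by auto
  have xh: "x1 \<in> hom C (Cod C f) (Cod C x1)" "x2 \<in> hom C (Cod C f) (Cod C x2)"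
    using x unfolding is_product_diagram_def hom_def by auto
  have fh: "f \<in> hom C (Dom C f) (Cod C f)" using f by (simp add: hom_def)
  show "is_pushout C f a1 x1 f1 \<and> is_pushout C f a2 x2 f2"
    using product_square_pushout[OF a(1) ah x(1) xh fh fi sq]
      product_square_pushout[OF product_swap[OF a(1)] ah(2,1) product_swap[OF x(1)] xh(2,1)
        fh fi(2,1) sq(2,1)] by blast
qed

end

section \<open>Condition (C1)\<close>

text \<open>The parallel pairs \<open>s\<close> on \<open>Y\<^sub>1\<close> and \<open>t\<close> on \<open>Y\<^sub>2\<close> turn out to be equivalence relations, and
  \<open>X\<close> to be the product of their quotients.\<close>

locale decomposed_quotient = split_coextensive_exact C for C :: "('o, 'm) cat" (structure) +
  fixes Y X R Y1 Y2 Z1 Z2 :: 'o and e r0 r1 y1 y2 z1 z2 s0 s1 t0 t1 :: 'm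
  assumes e: "e \<in> hom C Y X" "regular_epi C e"
    and r: "is_kernel_pair C e r0 r1" "r0 \<in> hom C R Y" "r1 \<in> hom C R Y"
    and y: "is_product_diagram C y1 y2" "y1 \<in> hom C Y Y1" "y2 \<in> hom C Y Y2"
    and z: "is_product_diagram C z1 z2" "z1 \<in> hom C R Z1" "z2 \<in> hom C R Z2"
    and s: "s0 \<in> hom C Z1 Y1" "s1 \<in> hom C Z1 Y1" "s0 \<cdot> z1 = y1 \<cdot> r0" "s1 \<cdot> z1 = y1 \<cdot> r1"
    and t: "t0 \<in> hom C Z2 Y2" "t1 \<in> hom C Z2 Y2" "t0 \<cdot> z2 = y2 \<cdot> r0" "t1 \<cdot> z2 = y2 \<cdot> r1"
begin

text \<open>Exchanging the two factors is a symmetry of the situation, so results about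
  \<open>s0, s1\<close> transfer to \<open>t0, t1\<close>.\<close>

lemma swap: "decomposed_quotient C Y X R Y2 Y1 Z2 Z1 e r0 r1 y2 y1 z2 z1 t0 t1 s0 s1"
  by unfold_locales (fact e r y s t z product_swap[OF y(1)] product_swap[OF z(1)])+

lemma relation_components:
  assumes "w \<in> hom C T R"
  shows "y1 \<cdot> (r0 \<cdot> w) = s0 \<cdot> (z1 \<cdot> w)" "y1 \<cdot> (r1 \<cdot> w) = s1 \<cdot> (z1 \<cdot> w)"
    "y2 \<cdot> (r0 \<cdot> w) = t0 \<cdot> (z2 \<cdot> w)" "y2 \<cdot> (r1 \<cdot> w) = t1 \<cdot> (z2 \<cdot> w)"
  using assms r(2,3) y(2,3) z(2,3) s(1,2) t(1,2)
    s(3,4)[THEN comp_eq_comp] t(3,4)[THEN comp_eq_comp]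
  by (simp_all add: hom_def)

lemma relation_comp: "w \<in> hom C T R \<Longrightarrow> e \<cdot> (r0 \<cdot> w) = e \<cdot> (r1 \<cdot> w)"
  using e(1) r(2,3) comp_eq_comp[OF pullback_arrows(5)[OF r(1)[unfolded is_kernel_pair_def]]]
  by (simp add: hom_def)

text \<open>As \<open>R\<close> is the product of \<open>Z1\<close> and \<open>Z2\<close>, an
  element of \<open>Z1\<close> and one of \<open>Z2\<close> combine to an element of
  \<open>R\<close>. This is how properties of the kernel pair reach its components.\<close>

lemma relation_lift:
  assumes u: "u \<in> hom C T Z1" and v: "v \<in> hom C T Z2"
  obtains w where "w \<in> hom C T R" "z1 \<cdot> w = u" "z2 \<cdot> w = v"
    "y1 \<cdot> (r0 \<cdot> w) = s0 \<cdot> u" "y1 \<cdot> (r1 \<cdot> w) = s1 \<cdot> u"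
    "y2 \<cdot> (r0 \<cdot> w) = t0 \<cdot> v" "y2 \<cdot> (r1 \<cdot> w) = t1 \<cdot> v"
proof -
  obtain w where w: "w \<in> hom C T R" "z1 \<cdot> w = u" "z2 \<cdot> w = v" using product_lift[OF z u v] .
  show ?thesis using that[OF w] relation_components[OF w(1)] w by simp
qed

lemma relation_homs:
  "w \<in> hom C T R \<Longrightarrow> r0 \<cdot> w \<in> hom C T Y" "w \<in> hom C T R \<Longrightarrow> r1 \<cdot> w \<in> hom C T Y"
  using r by (auto simp: hom_def)

text \<open>Over the cover \<open>T \<times> Z2\<close>, pad \<open>h\<close> and \<open>k\<close>
  with the same element \<open>n\<close> of \<open>Z2\<close>. The resulting elements of
  \<open>R\<close> agree under \<open>r0\<close> and \<open>r1\<close>, hence coincide, and the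
  projection \<open>m\<close> cancels.\<close>

lemma component_monic:
  assumes h: "h \<in> hom C T Z1" and k: "k \<in> hom C T Z1"
    and hk: "s0 \<cdot> h = s0 \<cdot> k" "s1 \<cdot> h = s1 \<cdot> k"
  shows "h = k"
proof -
  have "T \<in> Obj C" "Z2 \<in> Obj C" using h z hom_dom_obj hom_cod_obj by blast+
  then obtain S m n where m: "m \<in> hom C S T" "n \<in> hom C S Z2" "is_product_diagram C m n"
    using product_exists by blast
  have hm: "h \<cdot> m \<in> hom C S Z1" and km: "k \<cdot> m \<in> hom C S Z1" using h k m by (auto simp: hom_def)
  obtain w where w: "w \<in> hom C S R" "z1 \<cdot> w = h \<cdot> m" "z2 \<cdot> w = n"
      "y1 \<cdot> (r0 \<cdot> w) = s0 \<cdot> (h \<cdot> m)" "y1 \<cdot> (r1 \<cdot> w) = s1 \<cdot> (h \<cdot> m)"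
      "y2 \<cdot> (r0 \<cdot> w) = t0 \<cdot> n" "y2 \<cdot> (r1 \<cdot> w) = t1 \<cdot> n"
    using relation_lift[OF hm m(2)] .
  obtain w' where w': "w' \<in> hom C S R" "z1 \<cdot> w' = k \<cdot> m" "z2 \<cdot> w' = n"
      "y1 \<cdot> (r0 \<cdot> w') = s0 \<cdot> (k \<cdot> m)" "y1 \<cdot> (r1 \<cdot> w') = s1 \<cdot> (k \<cdot> m)"
      "y2 \<cdot> (r0 \<cdot> w') = t0 \<cdot> n" "y2 \<cdot> (r1 \<cdot> w') = t1 \<cdot> n"
    using relation_lift[OF km m(2)] .
  have hkm: "s0 \<cdot> (h \<cdot> m) = s0 \<cdot> (k \<cdot> m)" "s1 \<cdot> (h \<cdot> m) = s1 \<cdot> (k \<cdot> m)"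
    using h k m(1) s(1,2) hk[THEN comp_eq_comp] by (simp_all add: hom_def)
  have "r0 \<cdot> w = r0 \<cdot> w'"
    by (rule product_eqI[OF y relation_homs(1)[OF w(1)] relation_homs(1)[OF w'(1)]])
      (simp_all add: w w' hkm)
  moreover have "r1 \<cdot> w = r1 \<cdot> w'"
    by (rule product_eqI[OF y relation_homs(2)[OF w(1)] relation_homs(2)[OF w'(1)]])
      (simp_all add: w w' hkm)
  ultimately have "w = w'" using kernel_pair_eqI[OF r w(1) w'(1)] by blast
  then have "h \<cdot> m = k \<cdot> m" using w w' by simp
  then show "h = k" using product_fst_cancel[OF m(3,1,2) h k] by blast
qed

text \<open>The diagonal of \<open>R\<close> followed by \<open>z1\<close> is defined on
  \<open>Y\<close>; it descends along the regular epimorphism \<open>y1\<close> because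
  \<open>s0, s1\<close> are jointly monic.\<close>

lemma component_reflexive: "\<exists>d\<in>hom C Y1 Z1. s0 \<cdot> d = Id C Y1 \<and> s1 \<cdot> d = Id C Y1"
proof -
  have Y: "Y \<in> Obj C" "Y1 \<in> Obj C" using y hom_dom_obj hom_cod_obj by blast+
  obtain d where d: "d \<in> hom C Y R" "r0 \<cdot> d = Id C Y" "r1 \<cdot> d = Id C Y"
    using kernel_pair_lift[OF r id_hom id_hom] Y by blast
  show ?thesis
    by (rule fill_in[OF product_fst_regular_epi[OF y] y(2), of "z1 \<cdot> d" Z1 s0 Y1 s1 Y1])
      (use d(1) z(2) s(1,2) y(2) id_hom[OF Y(2)] component_monic relation_components[OF d(1)] d(2,3)
        in \<open>auto simp: hom_def\<close>)
qed

text \<open>The symmetry of \<open>R\<close> descends in the same way, now along the projection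
  \<open>z1\<close>.\<close>

lemma component_symmetric: "\<exists>c\<in>hom C Z1 Z1. s0 \<cdot> c = s1 \<and> s1 \<cdot> c = s0"
proof -
  obtain c where c: "c \<in> hom C R R" "r0 \<cdot> c = r1" "r1 \<cdot> c = r0"
    using kernel_pair_lift[OF r r(3,2)] pullback_arrows(5)[OF r(1)[unfolded is_kernel_pair_def]]
    by metis
  show ?thesis
    by (rule fill_in[OF product_fst_regular_epi[OF z] z(2), of "z1 \<cdot> c" Z1 s0 Y1 s1 Y1])
      (use c(1) z(2) s component_monic relation_components[OF c(1)] c(2,3) in \<open>auto simp: hom_def\<close>)
qed

text \<open>On the cover \<open>P \<times> Y\<^sub>2 \<rightarrow> P\<close>, pairs in \<open>Z\<^sub>1\<close> are padded with reflexivity in \<open>Z\<^sub>2\<close>, so that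
  transitivity of \<open>R\<close> applies.\<close>

lemma component_transitive:
  assumes p: "p \<in> hom C P Z1" and q: "q \<in> hom C P Z1" and pq: "s1 \<cdot> p = s0 \<cdot> q"
  shows "\<exists>c\<in>hom C P Z1. s0 \<cdot> c = s0 \<cdot> p \<and> s1 \<cdot> c = s1 \<cdot> q"
proof -
  have "P \<in> Obj C" "Y2 \<in> Obj C" using p y hom_dom_obj hom_cod_obj by blast+
  then obtain S m n where m: "m \<in> hom C S P" "n \<in> hom C S Y2" "is_product_diagram C m n"
    using product_exists by blast
  obtain d where d: "d \<in> hom C Y2 Z2" "t0 \<cdot> d = Id C Y2" "t1 \<cdot> d = Id C Y2"
    using decomposed_quotient.component_reflexive[OF swap] by blast
  have pm: "p \<cdot> m \<in> hom C S Z1" and qm: "q \<cdot> m \<in> hom C S Z1" and dn: "d \<cdot> n \<in> hom C S Z2"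
    using p q m d by (auto simp: hom_def)
  have tdn: "t0 \<cdot> (d \<cdot> n) = n" "t1 \<cdot> (d \<cdot> n) = n"
    using t(1,2) d m(2) d(2,3)[THEN comp_eq_comp] by (simp_all add: hom_def)
  obtain w where w: "w \<in> hom C S R" "z1 \<cdot> w = p \<cdot> m" "z2 \<cdot> w = d \<cdot> n"
      "y1 \<cdot> (r0 \<cdot> w) = s0 \<cdot> (p \<cdot> m)" "y1 \<cdot> (r1 \<cdot> w) = s1 \<cdot> (p \<cdot> m)"
      "y2 \<cdot> (r0 \<cdot> w) = t0 \<cdot> (d \<cdot> n)" "y2 \<cdot> (r1 \<cdot> w) = t1 \<cdot> (d \<cdot> n)"
    using relation_lift[OF pm dn] .
  obtain w' where w': "w' \<in> hom C S R" "z1 \<cdot> w' = q \<cdot> m" "z2 \<cdot> w' = d \<cdot> n"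
      "y1 \<cdot> (r0 \<cdot> w') = s0 \<cdot> (q \<cdot> m)" "y1 \<cdot> (r1 \<cdot> w') = s1 \<cdot> (q \<cdot> m)"
      "y2 \<cdot> (r0 \<cdot> w') = t0 \<cdot> (d \<cdot> n)" "y2 \<cdot> (r1 \<cdot> w') = t1 \<cdot> (d \<cdot> n)"
    using relation_lift[OF qm dn] .
  have pqm: "s1 \<cdot> (p \<cdot> m) = s0 \<cdot> (q \<cdot> m)"
    using p q m(1) s(1,2) comp_eq_comp[OF pq] by (simp add: hom_def)
  have "r1 \<cdot> w = r0 \<cdot> w'"
    by (rule product_eqI[OF y relation_homs(2)[OF w(1)] relation_homs(1)[OF w'(1)]])
      (simp_all add: w w' tdn pqm)
  then have "e \<cdot> (r0 \<cdot> w) = e \<cdot> (r1 \<cdot> w')"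
    using relation_comp[OF w(1)] relation_comp[OF w'(1)] by simp
  then obtain v where v: "v \<in> hom C S R" "r0 \<cdot> v = r0 \<cdot> w" "r1 \<cdot> v = r1 \<cdot> w'"
    using kernel_pair_lift[OF r relation_homs(1)[OF w(1)] relation_homs(2)[OF w'(1)]] by blast
  have zv: "z1 \<cdot> v \<in> hom C S Z1" using v z by (auto simp: hom_def)
  have sp: "s0 \<cdot> p \<in> hom C P Y1" and sq: "s1 \<cdot> q \<in> hom C P Y1" using p q s by (auto simp: hom_def)
  have "s0 \<cdot> (z1 \<cdot> v) = (s0 \<cdot> p) \<cdot> m"
    using relation_components(1)[OF v(1)] v(2) w(4) p m(1) s(1) by (simp add: hom_def)
  moreover have "s1 \<cdot> (z1 \<cdot> v) = (s1 \<cdot> q) \<cdot> m"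
    using relation_components(2)[OF v(1)] v(3) w'(5) q m(1) s(2) by (simp add: hom_def)
  \<comment> \<open>The composite pair \<open>v\<close> exists only over the cover \<open>m\<close>;
    joint monicity of \<open>s0, s1\<close> brings \<open>z1 \<cdot> v\<close> down to
    \<open>P\<close>.\<close>
  ultimately show ?thesis
    using fill_in[OF product_fst_regular_epi[OF m(3,1,2)] m(1) zv s(1,2) sp sq] component_monic by blast
qed

text \<open>Exactness gives some \<open>f\<close> with kernel pair \<open>s0, s1\<close>. Its
  coequaliser \<open>q\<close> has the same kernel pair: \<open>f\<close> factors through
  \<open>q\<close>, so whatever \<open>q\<close> identifies, \<open>f\<close> identifies
  too.\<close>

lemma component_effective:
  obtains X1 q1 where "q1 \<in> hom C Y1 X1" "regular_epi C q1" "is_kernel_pair C q1 s0 s1"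
proof -
  have "equivalence_relation C s0 s1"
    by (rule equivalence_relationI[OF s(1,2)])
      (fact component_monic component_reflexive component_symmetric component_transitive)+
  then obtain f where f: "is_kernel_pair C f s0 s1"
    using exact unfolding barr_exact_def by blast
  then obtain q where q: "is_coequaliser C s0 s1 q" using kernel_pair_coequaliser by blast
  define X1 where "X1 = Cod C q"
  have qh: "q \<in> hom C Y1 X1" using q s(1) by (auto simp: is_coequaliser_def hom_def X1_def)
  note fa = pullback_arrows[OF f[unfolded is_kernel_pair_def]]
  have fh: "f \<in> hom C Y1 (Cod C f)" using fa(1,3) s(1) by (auto simp: hom_def)
  obtain i where i: "i \<in> hom C X1 (Cod C f)" "i \<cdot> q = f"
    using coequaliser_factor[OF q qh fh fa(5)] .
  have "is_pullback C q q s0 s1"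
  proof (rule pullbackI[OF qh qh s(1,2) coequaliser_arrows(3)[OF q qh]])
    fix T u v assume uv: "u \<in> hom C T Y1" "v \<in> hom C T Y1" "q \<cdot> u = q \<cdot> v"
    have "f \<cdot> u = f \<cdot> v"
      using i(1) qh uv by (simp add: hom_def flip: i(2))
    then show "\<exists>h\<in>hom C T Z1. s0 \<cdot> h = u \<and> s1 \<cdot> h = v"
      using kernel_pair_lift[OF f s(1,2) uv(1,2)] by blast
  qed (rule component_monic)
  moreover have "regular_epi C q" using q unfolding regular_epi_def by blast
  ultimately show ?thesis using that[OF qh] by (simp add: is_kernel_pair_def)
qed

end

section \<open>The quotients of the components and the maps induced on them from
  \<open>X\<close>\<close>

locale quotient_components = decomposed_quotient +
  fixes X1 X2 :: 'a and q1 q2 x1 x2 :: 'b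
  assumes q1: "q1 \<in> hom C Y1 X1" "regular_epi C q1" "is_kernel_pair C q1 s0 s1"
    and q2: "q2 \<in> hom C Y2 X2" "regular_epi C q2" "is_kernel_pair C q2 t0 t1"
    and x: "x1 \<in> hom C X X1" "x2 \<in> hom C X X2" "x1 \<cdot> e = q1 \<cdot> y1" "x2 \<cdot> e = q2 \<cdot> y2"
begin

text \<open>Over a common cover, lift \<open>h\<close> and \<open>k\<close> along \<open>e\<close>
  to \<open>v\<close> and \<open>w'\<close> in \<open>Y\<close>. Their components are identified by
  \<open>q1\<close> and \<open>q2\<close>, hence related in \<open>Z1\<close> and \<open>Z2\<close>;
  the two relations combine to one in \<open>R\<close>, so
  \<open>e \<cdot> v = e \<cdot> w'\<close>.\<close>

lemma components_eqI:
  assumes h: "h \<in> hom C T X" and k: "k \<in> hom C T X" and hk: "x1 \<cdot> h = x1 \<cdot> k" "x2 \<cdot> h = x2 \<cdot> k"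
  shows "h = k"
proof -
  obtain S c w where c: "regular_epi C c" "c \<in> hom C S T" "w \<in> hom C S Y" "e \<cdot> w = h \<cdot> c"
    using cover_lift[OF e(2,1) h] .
  have kc: "k \<cdot> c \<in> hom C S X" using k c by (auto simp: hom_def)
  obtain S' c' w' where c': "regular_epi C c'" "c' \<in> hom C S' S" "w' \<in> hom C S' Y"
      "e \<cdot> w' = (k \<cdot> c) \<cdot> c'"
    using cover_lift[OF e(2,1) kc] .
  define v where "v = w \<cdot> c'"
  have v: "v \<in> hom C S' Y" using c(3) c'(2) by (auto simp: v_def hom_def)
  have "e \<cdot> v = (e \<cdot> w) \<cdot> c'" using c(3) c'(2) e(1) by (simp add: v_def hom_def)
  then have ev: "e \<cdot> v = (h \<cdot> c) \<cdot> c'" by (simp only: c(4))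
  have "x1 \<cdot> (e \<cdot> v) = x1 \<cdot> (e \<cdot> w')" "x2 \<cdot> (e \<cdot> v) = x2 \<cdot> (e \<cdot> w')"
    unfolding ev c'(4) using h k c(2) c'(2) x(1,2) hk[THEN comp_eq_comp] by (simp_all add: hom_def)
  then have "q1 \<cdot> (y1 \<cdot> v) = q1 \<cdot> (y1 \<cdot> w')" "q2 \<cdot> (y2 \<cdot> v) = q2 \<cdot> (y2 \<cdot> w')"
    using x(1,2) e(1) q1(1) q2(1) y(2,3) v c'(3) x(3,4)[THEN comp_eq_comp]
    by (simp_all add: hom_def)
  moreover have "y1 \<cdot> v \<in> hom C S' Y1" "y1 \<cdot> w' \<in> hom C S' Y1" "y2 \<cdot> v \<in> hom C S' Y2"
    "y2 \<cdot> w' \<in> hom C S' Y2"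
    using v c'(3) y by (auto simp: hom_def)
  ultimately obtain m1 m2 where m1: "m1 \<in> hom C S' Z1" "s0 \<cdot> m1 = y1 \<cdot> v" "s1 \<cdot> m1 = y1 \<cdot> w'"
    and m2: "m2 \<in> hom C S' Z2" "t0 \<cdot> m2 = y2 \<cdot> v" "t1 \<cdot> m2 = y2 \<cdot> w'"
    using kernel_pair_lift[OF q1(3) s(1,2)] kernel_pair_lift[OF q2(3) t(1,2)] by metis
  obtain m where m: "m \<in> hom C S' R" "z1 \<cdot> m = m1" "z2 \<cdot> m = m2"
      "y1 \<cdot> (r0 \<cdot> m) = s0 \<cdot> m1" "y1 \<cdot> (r1 \<cdot> m) = s1 \<cdot> m1"
      "y2 \<cdot> (r0 \<cdot> m) = t0 \<cdot> m2" "y2 \<cdot> (r1 \<cdot> m) = t1 \<cdot> m2"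
    using relation_lift[OF m1(1) m2(1)] .
  have "r0 \<cdot> m = v"
    by (rule product_eqI[OF y relation_homs(1)[OF m(1)] v]) (simp_all add: m m1 m2)
  moreover have "r1 \<cdot> m = w'"
    by (rule product_eqI[OF y relation_homs(2)[OF m(1)] c'(3)]) (simp_all add: m m1 m2)
  ultimately have "e \<cdot> v = e \<cdot> w'" using relation_comp[OF m(1)] by simp
  then have "(h \<cdot> c) \<cdot> c' = (k \<cdot> c) \<cdot> c'" by (simp only: ev c'(4))
  moreover have "h \<cdot> c \<in> hom C S X" using h c by (auto simp: hom_def)
  ultimately have "h \<cdot> c = k \<cdot> c" using regular_epi_cancel[OF c'(1,2)] kc by blast
  then show "h = k" using regular_epi_cancel[OF c(1,2)] h k by blast
qed

text \<open>For existence, lift \<open>u\<close> along \<open>q1\<close> and \<open>v\<close> along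
  \<open>q2\<close> over successive covers, pair the lifts in \<open>Y\<close> and apply
  \<open>e\<close>; joint monicity of \<open>x1, x2\<close> lets the result descend.\<close>

lemma quotient_product: "is_product_diagram C x1 x2"
proof (rule product_diagramI[OF x(1,2)])
  fix T u v assume u: "u \<in> hom C T X1" and v: "v \<in> hom C T X2"
  obtain S c w1 where c: "regular_epi C c" "c \<in> hom C S T" "w1 \<in> hom C S Y1" "q1 \<cdot> w1 = u \<cdot> c"
    using cover_lift[OF q1(2,1) u] .
  have uc: "u \<cdot> c \<in> hom C S X1" and vc: "v \<cdot> c \<in> hom C S X2" using u v c by (auto simp: hom_def)
  obtain S' c' w2 where c': "regular_epi C c'" "c' \<in> hom C S' S" "w2 \<in> hom C S' Y2"
      "q2 \<cdot> w2 = (v \<cdot> c) \<cdot> c'"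
    using cover_lift[OF q2(2,1) vc] .
  have wc: "w1 \<cdot> c' \<in> hom C S' Y1" using c c' by (auto simp: hom_def)
  obtain w where w: "w \<in> hom C S' Y" "y1 \<cdot> w = w1 \<cdot> c'" "y2 \<cdot> w = w2"
    using product_lift[OF y wc c'(3)] .
  have ew: "e \<cdot> w \<in> hom C S' X" using e w by (auto simp: hom_def)
  have "x1 \<cdot> (e \<cdot> w) = q1 \<cdot> (y1 \<cdot> w)" "x2 \<cdot> (e \<cdot> w) = q2 \<cdot> (y2 \<cdot> w)"
    using x(1,2) e(1) q1(1) q2(1) y(2,3) w(1) x(3,4)[THEN comp_eq_comp] by (simp_all add: hom_def)
  moreover have "q1 \<cdot> (w1 \<cdot> c') = (u \<cdot> c) \<cdot> c'"
    using comp_eq_comp[OF c(4)] q1(1) c(3) c'(2) by (simp add: hom_def)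
  ultimately have "x1 \<cdot> (e \<cdot> w) = (u \<cdot> c) \<cdot> c'" "x2 \<cdot> (e \<cdot> w) = (v \<cdot> c) \<cdot> c'"
    by (simp_all only: w c'(4))
  \<comment> \<open>The covers are removed one at a time: first \<open>c'\<close>, giving an arrow
    on \<open>S\<close>, and afterwards \<open>c\<close>.\<close>
  then obtain k where k: "k \<in> hom C S X" "x1 \<cdot> k = u \<cdot> c" "x2 \<cdot> k = v \<cdot> c"
    using fill_in[OF c'(1,2) ew x(1,2) uc vc] components_eqI by blast
  show "\<exists>h\<in>hom C T X. x1 \<cdot> h = u \<and> x2 \<cdot> h = v"
    by (rule fill_in[OF c(1,2) k(1) x(1,2) u v k(2,3) components_eqI])
qed (rule components_eqI)

text \<open>A cocone \<open>(u, v)\<close> on \<open>f\<close> becomes the cocone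
  \<open>(u \<cdot> e, v)\<close> on \<open>g\<close> and factors through \<open>Y1\<close> by some
  \<open>k\<close>. As \<open>u \<cdot> e\<close> identifies \<open>r0\<close> and
  \<open>r1\<close>, \<open>k\<close> identifies \<open>s0\<close> and \<open>s1\<close>, and so it
  descends along \<open>q1\<close>.\<close>

lemma quotient_pushout:
  assumes f: "f \<in> hom C A X" and g: "g \<in> hom C A Y" "e \<cdot> g = f"
    and a1: "a1 \<in> hom C A A1" and g1: "g1 \<in> hom C A1 Y1" and po: "is_pushout C g a1 y1 g1"
  shows "is_pushout C f a1 x1 (q1 \<cdot> g1)"
proof (rule pushoutI[OF f a1 x(1)])
  have sq: "g1 \<cdot> a1 = y1 \<cdot> g" using pushout_arrows(3)[OF po] .
  show qg: "q1 \<cdot> g1 \<in> hom C A1 X1" using q1 g1 by (auto simp: hom_def)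
  have "(q1 \<cdot> g1) \<cdot> a1 = (q1 \<cdot> y1) \<cdot> g" using sq q1(1) g1 a1 g(1) y(2) by (simp add: hom_def)
  also have "\<dots> = (x1 \<cdot> e) \<cdot> g" by (simp only: x(3))
  also have "\<dots> = x1 \<cdot> f" using x(1) e(1) g by (simp add: hom_def)
  finally show "(q1 \<cdot> g1) \<cdot> a1 = x1 \<cdot> f" .
  fix T u v assume uv: "u \<in> hom C X T" "v \<in> hom C A1 T" "v \<cdot> a1 = u \<cdot> f"
  have ue: "u \<cdot> e \<in> hom C Y T" using uv e by (auto simp: hom_def)
  have "v \<cdot> a1 = (u \<cdot> e) \<cdot> g" using uv e(1) g by (simp add: hom_def)
  then obtain k where k: "k \<in> hom C Y1 T" "k \<cdot> y1 = u \<cdot> e" "k \<cdot> g1 = v"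
    using pushout_factor[OF po y(2) g1 ue uv(2)] by blast
  \<comment> \<open>Checked after the projection \<open>z1\<close>, where the pair
    \<open>s0, s1\<close> turns into \<open>r0, r1\<close>.\<close>
  have "k \<cdot> s0 = k \<cdot> s1"
  proof (rule product_fst_cancel[OF z])
    have "(k \<cdot> s0) \<cdot> z1 = (k \<cdot> y1) \<cdot> r0" "(k \<cdot> s1) \<cdot> z1 = (k \<cdot> y1) \<cdot> r1"
      using k(1) s y(2) z(2) r(2,3) by (simp_all add: hom_def)
    moreover have "(u \<cdot> e) \<cdot> r0 = (u \<cdot> e) \<cdot> r1"
      using uv(1) e(1) r(2,3) pullback_arrows(5)[OF r(1)[unfolded is_kernel_pair_def]]
      by (simp add: hom_def)
    ultimately show "(k \<cdot> s0) \<cdot> z1 = (k \<cdot> s1) \<cdot> z1" by (simp only: k(2))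
  qed (use k(1) s in \<open>auto simp: hom_def\<close>)
  then obtain h where h: "h \<in> hom C X1 T" "h \<cdot> q1 = k"
    using regular_epi_kernel_pair_factor[OF q1(2,1,3) s(1,2) k(1)] by blast
  have "h \<cdot> x1 = u"
  proof (rule regular_epi_cancel[OF e(2,1)])
    have "(h \<cdot> x1) \<cdot> e = (h \<cdot> q1) \<cdot> y1" using h(1) x(1,3) e(1) q1(1) y(2) by (simp add: hom_def)
    then show "(h \<cdot> x1) \<cdot> e = u \<cdot> e" by (simp only: h(2) k(2))
  qed (use h(1) x(1) uv(1) in \<open>auto simp: hom_def\<close>)
  moreover have "h \<cdot> (q1 \<cdot> g1) = v"
  proof -
    have "h \<cdot> (q1 \<cdot> g1) = (h \<cdot> q1) \<cdot> g1" using h(1) q1(1) g1 by (simp add: hom_def)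
    then show ?thesis by (simp only: h(2) k(3))
  qed
  ultimately show "\<exists>h\<in>hom C X1 T. h \<cdot> x1 = u \<and> h \<cdot> (q1 \<cdot> g1) = v" using h(1) by blast
next
  fix T h k assume "h \<in> hom C X1 T" "k \<in> hom C X1 T" "h \<cdot> x1 = k \<cdot> x1"
  then show "h = k" using product_fst_cancel[OF quotient_product x(1,2)] by blast
qed

end

context decomposed_quotient
begin

text \<open>\<open>q1 \<cdot> y1\<close> identifies \<open>r0\<close> and \<open>r1\<close>, because
  \<open>y1\<close> carries them to \<open>s0\<close> and \<open>s1\<close> after \<open>z1\<close>;
  hence it factors through \<open>e\<close> as \<open>x1\<close>, and likewise for
  \<open>x2\<close>. Both orders of the factors are provided so that the pushout result applies to
  each of them.\<close>

lemma quotient_components_exist: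
  obtains X1 X2 q1 q2 x1 x2 where
    "quotient_components C Y X R Y1 Y2 Z1 Z2 e r0 r1 y1 y2 z1 z2 s0 s1 t0 t1 X1 X2 q1 q2 x1 x2"
    "quotient_components C Y X R Y2 Y1 Z2 Z1 e r0 r1 y2 y1 z2 z1 t0 t1 s0 s1 X2 X1 q2 q1 x2 x1"
proof -
  obtain X1 q1 where q1: "q1 \<in> hom C Y1 X1" "regular_epi C q1" "is_kernel_pair C q1 s0 s1"
    using component_effective .
  obtain X2 q2 where q2: "q2 \<in> hom C Y2 X2" "regular_epi C q2" "is_kernel_pair C q2 t0 t1"
    using decomposed_quotient.component_effective[OF swap] .
  have qy: "q1 \<cdot> y1 \<in> hom C Y X1" "q2 \<cdot> y2 \<in> hom C Y X2" using q1 q2 y by (auto simp: hom_def)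
  note qs = q1(3)[unfolded is_kernel_pair_def, THEN pullback_arrows(5)]
    q2(3)[unfolded is_kernel_pair_def, THEN pullback_arrows(5)]
  have "(q1 \<cdot> y1) \<cdot> r0 = (q1 \<cdot> s0) \<cdot> z1" "(q1 \<cdot> y1) \<cdot> r1 = (q1 \<cdot> s1) \<cdot> z1"
    "(q2 \<cdot> y2) \<cdot> r0 = (q2 \<cdot> t0) \<cdot> z2" "(q2 \<cdot> y2) \<cdot> r1 = (q2 \<cdot> t1) \<cdot> z2"
    using q1(1) q2(1) y(2,3) r(2,3) z(2,3) s t by (simp_all add: hom_def)
  then have "(q1 \<cdot> y1) \<cdot> r0 = (q1 \<cdot> y1) \<cdot> r1" "(q2 \<cdot> y2) \<cdot> r0 = (q2 \<cdot> y2) \<cdot> r1"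
    by (simp_all only: qs)
  then obtain x1 x2 where x: "x1 \<in> hom C X X1" "x1 \<cdot> e = q1 \<cdot> y1" "x2 \<in> hom C X X2" "x2 \<cdot> e = q2 \<cdot> y2"
    using regular_epi_kernel_pair_factor[OF e(2,1) r qy(1)]
      regular_epi_kernel_pair_factor[OF e(2,1) r qy(2)] by metis
  have "quotient_components C Y X R Y1 Y2 Z1 Z2 e r0 r1 y1 y2 z1 z2 s0 s1 t0 t1 X1 X2 q1 q2 x1 x2"
    by unfold_locales (fact q1 q2 x)+
  moreover have "quotient_components C Y X R Y2 Y1 Z2 Z1 e r0 r1 y2 y1 z2 z1 t0 t1 s0 s1 X2 X1 q2 q1 x2 x1"
    by (intro quotient_components.intro swap quotient_components_axioms.intro) (fact q1 q2 x)+
  ultimately show ?thesis using that by blast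
qed

end

section \<open>(C1) for arbitrary morphisms\<close>

context split_coextensive_exact
begin

lemma split_mono_pushouts:
  assumes g: "split_mono C g" "g \<in> hom C A Y"
    and a: "is_product_diagram C a1 a2" "a1 \<in> hom C A A1" "a2 \<in> hom C A A2"
  obtains Y1 y1 g1 Y2 y2 g2 where
    "is_pushout C g a1 y1 g1" "y1 \<in> hom C Y Y1" "g1 \<in> hom C A1 Y1"
    "is_pushout C g a2 y2 g2" "y2 \<in> hom C Y Y2" "g2 \<in> hom C A2 Y2"
    "is_product_diagram C y1 y2"
proof -
  have eqs: "Dom C a1 = Dom C g" "Cod C g = Y" "Cod C a1 = A1" "Cod C a2 = A2"
    using g(2) a(2,3) by (auto simp: hom_def)
  note c1 = split_mono_coextensive(1)[OF g(1), unfolded coextensive_C1_def, rule_format,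
      OF conjI, OF a(1) eqs(1)]
  obtain y1 g1 where p1: "is_pushout C g a1 y1 g1" using c1 by blast
  obtain y2 g2 where p2: "is_pushout C g a2 y2 g2" using c1 by blast
  have "is_product_diagram C y1 y2" using c1 p1 p2 by blast
  then show ?thesis
    using that[OF p1 _ _ p2] pushout_arrows(1,2)[OF p1] pushout_arrows(1,2)[OF p2]
    unfolding eqs by blast
qed

text \<open>(C1) is applied to two split monomorphisms: the graph \<open>g\<close> into
  \<open>Y\<close> and \<open>d = (g, g)\<close> into the kernel pair \<open>R\<close> of
  \<open>e\<close>. Their pushouts supply the decompositions of \<open>Y\<close> and
  \<open>R\<close> from which the component quotients are formed.\<close>

lemma product_pushouts_exist:
  assumes f: "f \<in> hom C A X"
    and a: "is_product_diagram C a1 a2" "a1 \<in> hom C A A1" "a2 \<in> hom C A A2"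
  obtains x1 f1 x2 f2 where "is_pushout C f a1 x1 f1" "is_pushout C f a2 x2 f2"
    "is_product_diagram C x1 x2"
proof -
  obtain Y p e g where p: "is_product_diagram C p e" "p \<in> hom C Y A" "e \<in> hom C Y X"
    and g: "g \<in> hom C A Y" "p \<cdot> g = Id C A" "e \<cdot> g = f" "split_mono C g"
    using graph_exists[OF f] .
  obtain R r0 r1 where r: "r0 \<in> hom C R Y" "r1 \<in> hom C R Y" "is_kernel_pair C e r0 r1"
    using kernel_pair_exists[OF p(3)] .
  obtain d where d: "d \<in> hom C A R" "r0 \<cdot> d = g" "r1 \<cdot> d = g"
    using kernel_pair_lift[OF r(3,1,2) g(1) g(1) refl] .
  \<comment> \<open>The retraction of the graph, preceded by \<open>r0\<close>, is a retraction of
    \<open>d\<close>.\<close>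
  have "(p \<cdot> r0) \<cdot> d = Id C A" using p(2) r(1) d(1,2) g(2) by (simp add: hom_def)
  moreover have "p \<cdot> r0 \<in> hom C R A" using p r by (auto simp: hom_def)
  ultimately have sd: "split_mono C d" using d(1) by (auto simp: split_mono_def hom_def)
  obtain Y1 y1 g1 Y2 y2 g2 where
    y1: "is_pushout C g a1 y1 g1" "y1 \<in> hom C Y Y1" "g1 \<in> hom C A1 Y1" and
    y2: "is_pushout C g a2 y2 g2" "y2 \<in> hom C Y Y2" "g2 \<in> hom C A2 Y2" and
    y: "is_product_diagram C y1 y2"
    using split_mono_pushouts[OF g(4,1) a] .
  obtain Z1 z1 d1 Z2 z2 d2 where
    z1: "is_pushout C d a1 z1 d1" "z1 \<in> hom C R Z1" "d1 \<in> hom C A1 Z1" and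
    z2: "is_pushout C d a2 z2 d2" "z2 \<in> hom C R Z2" "d2 \<in> hom C A2 Z2" and
    z: "is_product_diagram C z1 z2"
    using split_mono_pushouts[OF sd d(1) a] .
  \<comment> \<open>Since \<open>r' \<cdot> d = g\<close>, the arrows \<open>y' \<cdot> r'\<close>
    and \<open>g'\<close> form a cocone on \<open>d\<close> and \<open>a'\<close>; its factorisation
    through \<open>Z'\<close> is the component of \<open>r'\<close>.\<close>
  have induced: "\<exists>s\<in>hom C Z' Y'. s \<cdot> z' = y' \<cdot> r'"
    if "is_pushout C g a' y' g'" "y' \<in> hom C Y Y'" "g' \<in> hom C A' Y'"
      "is_pushout C d a' z' d'" "z' \<in> hom C R Z'" "d' \<in> hom C A' Z'"
      "r' \<in> hom C R Y" "r' \<cdot> d = g" for a' A' y' Y' g' z' Z' d' r'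
  proof -
    have "g' \<cdot> a' = (y' \<cdot> r') \<cdot> d"
      using pushout_arrows(3)[OF that(1)] that d(1) by (simp add: hom_def)
    moreover have "y' \<cdot> r' \<in> hom C R Y'" using that by (auto simp: hom_def)
    ultimately show ?thesis using pushout_factor[OF that(4-6) _ that(3)] by blast
  qed
  obtain s0 s1 where s: "s0 \<in> hom C Z1 Y1" "s0 \<cdot> z1 = y1 \<cdot> r0" "s1 \<in> hom C Z1 Y1" "s1 \<cdot> z1 = y1 \<cdot> r1"
    using induced[OF y1 z1 r(1) d(2)] induced[OF y1 z1 r(2) d(3)] by blast
  obtain t0 t1 where t: "t0 \<in> hom C Z2 Y2" "t0 \<cdot> z2 = y2 \<cdot> r0" "t1 \<in> hom C Z2 Y2" "t1 \<cdot> z2 = y2 \<cdot> r1"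
    using induced[OF y2 z2 r(1) d(2)] induced[OF y2 z2 r(2) d(3)] by blast
  have dq: "decomposed_quotient C Y X R Y1 Y2 Z1 Z2 e r0 r1 y1 y2 z1 z2 s0 s1 t0 t1"
    by unfold_locales (fact p r y y1 y2 z z1 z2 s t product_snd_regular_epi[OF p])+
  obtain X1 X2 q1 q2 x1 x2 where
    qc: "quotient_components C Y X R Y1 Y2 Z1 Z2 e r0 r1 y1 y2 z1 z2 s0 s1 t0 t1 X1 X2 q1 q2 x1 x2"
      "quotient_components C Y X R Y2 Y1 Z2 Z1 e r0 r1 y2 y1 z2 z1 t0 t1 s0 s1 X2 X1 q2 q1 x2 x1"
    using decomposed_quotient.quotient_components_exist[OF dq] .
  show ?thesis
    using that quotient_components.quotient_pushout[OF qc(1) f g(1,3) a(2) y1(3,1)]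
      quotient_components.quotient_pushout[OF qc(2) f g(1,3) a(3) y2(3,1)]
      quotient_components.quotient_product[OF qc(1)] by blast
qed

lemma coextensive_C1:
  assumes f: "f \<in> Arr C"
  shows "coextensive_C1 C f"
  unfolding coextensive_C1_def
proof (intro allI impI, elim conjE)
  fix a1 a2 assume a: "is_product_diagram C a1 a2" "Dom C a1 = Dom C f"
  have ah: "a1 \<in> hom C (Dom C f) (Cod C a1)" "a2 \<in> hom C (Dom C f) (Cod C a2)"
    using a unfolding is_product_diagram_def hom_def by auto
  have fh: "f \<in> hom C (Dom C f) (Cod C f)" using f by (simp add: hom_def)
  obtain x1 f1 x2 f2 where x: "is_pushout C f a1 x1 f1" "is_pushout C f a2 x2 f2"
    "is_product_diagram C x1 x2"
    using product_pushouts_exist[OF fh a(1) ah] .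
  \<comment> \<open>Any other pushouts are isomorphic to the constructed ones, compatibly with the
    arrows out of the codomain of \<open>f\<close>.\<close>
  have "is_product_diagram C x1' x2'"
    if x': "is_pushout C f a1 x1' f1'" "is_pushout C f a2 x2' f2'" for x1' f1' x2' f2'
  proof -
    obtain i1 j1 where i1: "i1 \<in> hom C (Cod C x1) (Cod C x1')" "j1 \<in> hom C (Cod C x1') (Cod C x1)"
      "i1 \<cdot> x1 = x1'" "i1 \<cdot> j1 = Id C (Cod C x1')" "j1 \<cdot> i1 = Id C (Cod C x1)"
      using pushout_unique[OF x(1) x'(1)] .
    obtain i2 j2 where i2: "i2 \<in> hom C (Cod C x2) (Cod C x2')" "j2 \<in> hom C (Cod C x2') (Cod C x2)"
      "i2 \<cdot> x2 = x2'" "i2 \<cdot> j2 = Id C (Cod C x2')" "j2 \<cdot> i2 = Id C (Cod C x2)"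
      using pushout_unique[OF x(2) x'(2)] .
    show ?thesis
      using product_diagram_iso[OF x(3) pushout_arrows(1)[OF x(1)] pushout_arrows(1)[OF x(2)]
          i1(1,2,4,5) i2(1,2,4,5)] i1(3) i2(3) by simp
  qed
  then show "(\<exists>x1 f1. is_pushout C f a1 x1 f1) \<and> (\<exists>x2 f2. is_pushout C f a2 x2 f2) \<and>
      (\<forall>x1 f1 x2 f2. is_pushout C f a1 x1 f1 \<and> is_pushout C f a2 x2 f2 \<longrightarrow> is_product_diagram C x1 x2)"
    using x by blast
qed

end

theorem proposition3p7:
  fixes C :: "('o, 'm) cat"
  assumes "barr_exact C"
  shows "(\<forall>f. split_mono C f \<longrightarrow> coextensive_morphism C f) \<longleftrightarrow> coextensive_category C"
proof
  assume "\<forall>f. split_mono C f \<longrightarrow> coextensive_morphism C f"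
  moreover have reg: "category C" "has_finite_limits C"
    using assms by (simp_all add: barr_exact_def regular_category_def)
  ultimately interpret split_coextensive_exact C
    using assms by (simp add: split_coextensive_exact_def split_coextensive_exact_axioms_def)
  have "has_finite_products C"
    using reg(2) by (simp add: has_finite_products_def has_finite_limits_def)
  then show "coextensive_category C"
    using reg(1) coextensive_C1 coextensive_C2
    by (simp add: coextensive_category_def coextensive_morphism_def)
next
  assume "coextensive_category C"
  then show "\<forall>f. split_mono C f \<longrightarrow> coextensive_morphism C f"
    by (simp add: coextensive_category_def split_mono_def)
qed

end
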